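(* Consider the projective space $\mathbb{R}P^3=S^3/\mathbb{Z}_2$ with the metric $$\bar g(t)=A_1^2(t)(e^1)^2+A_2^2(t)\big((e^2)^2+(e^3)^2\big)$$ changing under the action of the flow $$\frac{\partial}{\partial t}\bar g_{ij}=\frac12\sqrt{\det(\overline{Ric})}\;\overline{Ric}^{-1}_{ij},\qquad i,j\in\{1,2,3\}.$$ If $A_1(0)=0$, $A_1'(0)=2$, and $A_2(0)=a$, then the corresponding metric $$g=dt^2+A_1^2(t)(e^1)^2+A_2^2(t)\big((e^2)^2+(e^3)^2\big)$$ is isometric to the Eguchi--Hanson metric.
   Context: $S^3=Sp(1)$ is the group of unit quaternions, and $e^1,e^2,e^3$ are the $1$-forms dual to the three invariant vector fields on $S^3$ extending the basis $i,j,k$ of $T_1Sp(1)$, with sign convention $de^1=2e^2\wedge e^3$, $de^2=2e^3\wedge e^1$, $de^3=2e^1\wedge e^2$; they descend to $\mathbb{R}P^3=S^3/\{\pm1\}$. $A_1,A_2$ are functions of $t$. $\overline{Ric}$ is the $3\times3$ matrix of the Ricci tensor of $\bar g(t)$ in the orthonormal frame corresponding to $\varepsilon^1=A_1e^1$, $\varepsilon^2=A_2e^2$, $\varepsilon^3=A_2e^3$, and $\overline{Ric}^{-1}_{ij}$ are the components of its inverse matrix; components of tensors on $\mathbb{R}P^3$ are taken in this frame. The normalization of the Ricci tensor used is twice the usual one, so that $\overline{Ric}$ is diagonal with $$\overline{Ric}_{11}=4\frac{A_1^2}{A_2^4},\qquad \overline{Ric}_{22}=\overline{Ric}_{33}=\frac{4}{A_2^2}\Big(2-\frac{A_1^2}{A_2^2}\Big).$$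 The Eguchi--Hanson metric (with parameter $a$) is $$ds^2=\big[1-(a/r)^4\big]^{-1}dr^2+r^2\big((e^2)^2+(e^3)^2\big)+r^2\big[1-(a/r)^4\big](e^1)^2 .$$
   Formalization: With factor 1/2 the flow forces A_1'(0)=1, so the data are inconsistent; the theorem allows factor 1/2 or 1, and only 1 occurs. The solution is taken maximal in time, a>0, and the isometry is a homeomorphism, smooth and metric-preserving away from t=0 and r=a. *)

theory Defs
  imports "HOL-Analysis.Analysis"
begin

section \<open>Unit quaternions and the invariant coframe\<close>

text \<open>The quaternion \<open>z + w j\<close> is the pair \<open>(z, w)\<close>; the product norm is the quaternion norm.\<close>

type_synonym quat = "complex \<times> complex"

definition qmult :: "quat \<Rightarrow> quat \<Rightarrow> quat" where
  "qmult p q = (fst p * fst q - snd p * cnj (snd q), fst p * snd q + snd p * cnj (fst q))"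

definition S3 :: "quat set" where
  "S3 = sphere 0 1"

text \<open>The basis \<open>i, j, k\<close> of \<open>T\<^sub>1 Sp(1)\<close>.\<close>

definition qunit :: "3 \<Rightarrow> quat" where
  "qunit n = (if n = 1 then (\<i>, 0) else if n = 2 then (0, 1) else (0, \<i>))"

text \<open>The sign convention \<open>de\<^sup>1 = 2 e\<^sup>2 \<and> e\<^sup>3\<close> selects the invariant fields \<open>q \<mapsto> i q\<close>, and so on, rather
  than \<open>q \<mapsto> q i\<close>; see \<open>d_coframe\<close> below. All tensors are written on the ambient space of
  quaternions and are meant on the tangent spaces of \<^term>\<open>S3\<close>.\<close>

definition inv_field :: "3 \<Rightarrow> quat \<Rightarrow> quat" where
  "inv_field n q = qmult (qunit n) q"

definition coframe :: "3 \<Rightarrow> quat \<Rightarrow> quat \<Rightarrow> real" where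
  "coframe n q v = inv_field n q \<bullet> v"

section \<open>The metric \<open>A\<^sub>1\<^sup>2 (e\<^sup>1)\<^sup>2 + A\<^sub>2\<^sup>2 ((e\<^sup>2)\<^sup>2 + (e\<^sup>3)\<^sup>2)\<close> and its Ricci matrix\<close>

definition gbar :: "real \<Rightarrow> real \<Rightarrow> quat \<Rightarrow> quat \<Rightarrow> quat \<Rightarrow> real" where
  "gbar a1 a2 q v w = a1\<^sup>2 * (coframe 1 q v * coframe 1 q w)
     + a2\<^sup>2 * (coframe 2 q v * coframe 2 q w + coframe 3 q v * coframe 3 q w)"

text \<open>The orthonormal frame dual to \<open>A\<^sub>1 e\<^sup>1, A\<^sub>2 e\<^sup>2, A\<^sub>2 e\<^sup>3\<close>.\<close>

definition onframe :: "real \<Rightarrow> real \<Rightarrow> 3 \<Rightarrow> quat \<Rightarrow> quat" where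
  "onframe a1 a2 n q = (1 / (if n = 1 then a1 else a2)) *\<^sub>R inv_field n q"

definition lie_bracket :: "(quat \<Rightarrow> quat) \<Rightarrow> (quat \<Rightarrow> quat) \<Rightarrow> quat \<Rightarrow> quat" where
  "lie_bracket X Y q = frechet_derivative Y (at q) (X q) - frechet_derivative X (at q) (Y q)"

definition struct_coeff :: "real \<Rightarrow> real \<Rightarrow> quat \<Rightarrow> 3 \<Rightarrow> 3 \<Rightarrow> 3 \<Rightarrow> real" where
  "struct_coeff a1 a2 q i j k =
     gbar a1 a2 q (lie_bracket (onframe a1 a2 i) (onframe a1 a2 j) q) (onframe a1 a2 k q)"

text \<open>Koszul formula in an orthonormal frame: \<open>\<nabla>\<^bsub>E i\<^esub> (E j) = (\<Sum>k. conn_coeff i j k * E k)\<close>.\<close>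

definition conn_coeff :: "real \<Rightarrow> real \<Rightarrow> quat \<Rightarrow> 3 \<Rightarrow> 3 \<Rightarrow> 3 \<Rightarrow> real" where
  "conn_coeff a1 a2 q i j k =
     (struct_coeff a1 a2 q i j k - struct_coeff a1 a2 q j k i + struct_coeff a1 a2 q k i j) / 2"

text \<open>\<open>Ric(Y, Z)\<close> is the trace of \<open>X \<mapsto> \<nabla>\<^bsub>X\<^esub> \<nabla>\<^bsub>Y\<^esub> Z - \<nabla>\<^bsub>Y\<^esub> \<nabla>\<^bsub>X\<^esub> Z - \<nabla>\<^bsub>[X,Y]\<^esub> Z\<close>; no derivatives of
  the connection coefficients occur because these are constant for an invariant frame.
  The leading factor 2 is the normalization (twice the usual Ricci tensor).\<close>

definition Ric :: "real \<Rightarrow> real \<Rightarrow> quat \<Rightarrow> real^3^3" where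
  "Ric a1 a2 q = (\<chi> j k. 2 * (\<Sum>i\<in>UNIV. \<Sum>m\<in>UNIV.
       conn_coeff a1 a2 q j k m * conn_coeff a1 a2 q i m i
     - conn_coeff a1 a2 q i k m * conn_coeff a1 a2 q j m i
     - struct_coeff a1 a2 q i j m * conn_coeff a1 a2 q m k i))"

section \<open>The flow\<close>

text \<open>The equation is \<open>\<partial>\<^sub>t gbar\<^sub>i\<^sub>j = c sqrt(det Ric) Ric\<^sup>-\<^sup>1\<^sub>i\<^sub>j\<close> for \<open>0 < t < T\<close>, where the components at time
  \<open>t\<close> are those in the orthonormal frame of \<open>gbar(t)\<close>, held fixed during the differentiation.
  The nominal coefficient is \<open>c = 1/2\<close>, and \<open>c = 1\<close> is the same equation for the components of
  \<open>1/2 \<partial>\<^sub>t gbar\<close>, which are \<open>A\<^sub>n'/A\<^sub>n\<close> on the diagonal. With \<open>A\<^sub>1(0) = 0\<close> and \<open>A\<^sub>2(0) \<noteq> 0\<close> the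
  equation forces \<open>A\<^sub>1'(0) = 2 c\<close>, so only \<open>c = 1\<close> is compatible with \<open>A\<^sub>1'(0) = 2\<close>.
  At \<open>t = 0\<close> the metric may degenerate, so only continuity is required there.
  For \<open>A\<^sub>1, A\<^sub>2 > 0\<close> and \<open>A\<^sub>1\<^sup>2 < 2 A\<^sub>2\<^sup>2\<close> the flow is
  \<open>A\<^sub>1' = c (2 - A\<^sub>1\<^sup>2 / A\<^sub>2\<^sup>2)\<close>, \<open>A\<^sub>2' = c A\<^sub>1 / A\<^sub>2\<close>.\<close>

definition flow_solution :: "real \<Rightarrow> ereal \<Rightarrow> (real \<Rightarrow> real) \<Rightarrow> (real \<Rightarrow> real) \<Rightarrow> bool" where
  "flow_solution c T A1 A2 \<longleftrightarrow>
     continuous_on {t. 0 \<le> t \<and> ereal t < T} A1 \<and>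
     continuous_on {t. 0 \<le> t \<and> ereal t < T} A2 \<and>
     (\<forall>t. 0 < t \<and> ereal t < T \<longrightarrow>
        A1 t \<noteq> 0 \<and> A2 t \<noteq> 0 \<and>
        (\<forall>q\<in>S3. invertible (Ric (A1 t) (A2 t) q) \<and>
          (\<forall>i j. ((\<lambda>s. gbar (A1 s) (A2 s) q (onframe (A1 t) (A2 t) i q) (onframe (A1 t) (A2 t) j q))
             has_real_derivative
               c * sqrt (det (Ric (A1 t) (A2 t) q)) * matrix_inv (Ric (A1 t) (A2 t) q) $ i $ j)
             (at t))))"

definition maximal_flow_solution :: "real \<Rightarrow> ereal \<Rightarrow> (real \<Rightarrow> real) \<Rightarrow> (real \<Rightarrow> real) \<Rightarrow> bool" where
  "maximal_flow_solution c T A1 A2 \<longleftrightarrow>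
     flow_solution c T A1 A2 \<and>
     \<not> (\<exists>T' B1 B2. T < T' \<and> flow_solution c T' B1 B2 \<and>
          (\<forall>t. 0 \<le> t \<and> ereal t < T \<longrightarrow> B1 t = A1 t \<and> B2 t = A2 t))"

section \<open>Four-dimensional metrics on an interval times \<open>S\<^sup>3 / {1, -1}\<close>\<close>

type_synonym metric4 = "real \<times> quat \<Rightarrow> real \<times> quat \<Rightarrow> real \<times> quat \<Rightarrow> real"

definition cyl_metric :: "(real \<Rightarrow> real) \<Rightarrow> (real \<Rightarrow> real) \<Rightarrow> metric4" where
  "cyl_metric A1 A2 = (\<lambda>(t, q) (\<tau>, v) (\<sigma>, w). \<tau> * \<sigma> + gbar (A1 t) (A2 t) q v w)"

definition eguchi_hanson :: "real \<Rightarrow> metric4" where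
  "eguchi_hanson a = (\<lambda>(r, q) (\<rho>, v) (\<sigma>, w).
     inverse (1 - (a / r) ^ 4) * (\<rho> * \<sigma>)
     + r\<^sup>2 * (coframe 2 q v * coframe 2 q w + coframe 3 q v * coframe 3 q w)
     + r\<^sup>2 * (1 - (a / r) ^ 4) * (coframe 1 q v * coframe 1 q w))"

text \<open>Points of the 4-manifold with radial coordinate in \<open>[t0, T)\<close>, as classes of points of
  \<open>[t0, T) \<times> S\<^sup>3\<close>: a point of \<open>S\<^sup>3 / {1, -1}\<close> for radius \<open>t > t0\<close>, while at \<open>t = t0\<close>, where the
  coefficient of \<open>(e\<^sup>1)\<^sup>2\<close> vanishes, each circle tangent to the first invariant field is collapsed
  to a point (the two-sphere ``bolt'').\<close>

definition pt_class :: "real \<Rightarrow> real \<times> quat \<Rightarrow> (real \<times> quat) set" where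
  "pt_class t0 = (\<lambda>(t, q). if t = t0 then {t} \<times> range (\<lambda>\<theta>. qmult (cis \<theta>, 0) q)
                           else {t} \<times> {q, - q})"

definition cyl_closed :: "real \<Rightarrow> ereal \<Rightarrow> (real \<times> quat) set" where
  "cyl_closed t0 T = {t. t0 \<le> t \<and> ereal t < T} \<times> S3"

definition cyl_open :: "real \<Rightarrow> ereal \<Rightarrow> (real \<times> quat) set" where
  "cyl_open t0 T = {t. t0 < t \<and> ereal t < T} \<times> S3"

definition bolt_space :: "real \<Rightarrow> ereal \<Rightarrow> (real \<times> quat) set topology" where
  "bolt_space t0 T = topology (\<lambda>U. U \<subseteq> pt_class t0 ` cyl_closed t0 T \<and>
     openin (top_of_set (cyl_closed t0 T)) {p \<in> cyl_closed t0 T. pt_class t0 p \<in> U})"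

primrec Ck_on :: "nat \<Rightarrow> 'a::real_normed_vector set \<Rightarrow> ('a \<Rightarrow> 'b::real_normed_vector) \<Rightarrow> bool" where
  "Ck_on 0 U f \<longleftrightarrow> continuous_on U f"
| "Ck_on (Suc n) U f \<longleftrightarrow> (\<forall>x\<in>U. f differentiable (at x)) \<and>
     (\<forall>v. Ck_on n U (\<lambda>x. frechet_derivative f (at x) v))"

definition smooth_map_on :: "'a::real_normed_vector set \<Rightarrow> ('a \<Rightarrow> 'b::real_normed_vector) \<Rightarrow> bool" where
  "smooth_map_on U f \<longleftrightarrow> (\<forall>n. Ck_on n U f)"

text \<open>\<open>F\<close>, a map between spaces of classes, is smooth away from the bolt and pulls \<open>H\<close> back to \<open>G\<close>:
  near every point it is covered by a map \<open>\<phi>\<close> of (ambient neighbourhoods in) the cylinders over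
  \<open>S\<^sup>3\<close>. The double cover is a local diffeomorphism, so this is smoothness downstairs.\<close>

definition preserves_metric ::
    "((real \<times> quat) set \<Rightarrow> (real \<times> quat) set) \<Rightarrow>
     real \<Rightarrow> ereal \<Rightarrow> metric4 \<Rightarrow> real \<Rightarrow> ereal \<Rightarrow> metric4 \<Rightarrow> bool" where
  "preserves_metric F t0 T G s0 S H \<longleftrightarrow>
     (\<forall>p \<in> cyl_open t0 T. \<exists>U \<phi>. open U \<and> p \<in> U \<and> smooth_map_on U \<phi> \<and>
        (\<forall>x \<in> U \<inter> cyl_open t0 T.
           \<phi> x \<in> cyl_open s0 S \<and> F (pt_class t0 x) = pt_class s0 (\<phi> x) \<and>
           (\<forall>v w. snd x \<bullet> snd v = 0 \<and> snd x \<bullet> snd w = 0 \<longrightarrow>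
              H (\<phi> x) (frechet_derivative \<phi> (at x) v) (frechet_derivative \<phi> (at x) w) = G x v w)))"

text \<open>An isometry is a homeomorphism of the whole spaces, bolts included, which together with its
  inverse is smooth and metric preserving away from the bolts (where the coordinate
  expressions of both metrics degenerate).\<close>

definition isometric_metrics ::
    "real \<Rightarrow> ereal \<Rightarrow> metric4 \<Rightarrow> real \<Rightarrow> ereal \<Rightarrow> metric4 \<Rightarrow> bool" where
  "isometric_metrics t0 T G s0 S H \<longleftrightarrow>
     (\<exists>F F'. homeomorphic_maps (bolt_space t0 T) (bolt_space s0 S) F F' \<and>
        preserves_metric F t0 T G s0 S H \<and> preserves_metric F' s0 S H t0 T G)"

section \<open>The definitions agree with the stated conventions\<close>

lemma S3_iff: "q \<in> S3 \<longleftrightarrow> (Re (fst q))\<^sup>2 + (Im (fst q))\<^sup>2 + (Re (snd q))\<^sup>2 + (Im (snd q))\<^sup>2 = 1"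
proof -
  have "q \<in> S3 \<longleftrightarrow> (norm q)\<^sup>2 = 1"
    by (auto simp: S3_def power2_eq_1_iff) (smt (verit) norm_ge_zero)
  then show ?thesis
    by (simp add: norm_prod_def cmod_def add.assoc)
qed

lemma coframe_dual:
  assumes "q \<in> S3"
  shows "coframe m q (inv_field n q) = (if m = n then 1 else 0)"
  using assms exhaust_3[of m] exhaust_3[of n]
  by (auto simp: S3_iff coframe_def inv_field_def qmult_def qunit_def inner_prod_def inner_complex_def
      power2_eq_square algebra_simps)

lemma coframe_minus: "coframe n (- q) (- v) = coframe n q v"
  by (simp add: coframe_def inv_field_def qmult_def inner_prod_def inner_complex_def algebra_simps)

lemma tangent_expansion:
  assumes "q \<in> S3" "q \<bullet> v = 0"
  shows "v = coframe 1 q v *\<^sub>R inv_field 1 q + coframe 2 q v *\<^sub>R inv_field 2 q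
           + coframe 3 q v *\<^sub>R inv_field 3 q"
proof -
  obtain a b c d where q: "q = (Complex a b, Complex c d)"
    by (metis complex.exhaust prod.exhaust)
  obtain x y z u where v: "v = (Complex x y, Complex z u)"
    by (metis complex.exhaust prod.exhaust)
  have 1: "a\<^sup>2 + b\<^sup>2 + c\<^sup>2 + d\<^sup>2 = 1"
    using assms by (simp add: S3_iff q)
  have 2: "a * x + b * y + c * z + d * u = 0"
    using assms by (simp add: q v inner_prod_def inner_complex_def)
  show ?thesis
    unfolding q v coframe_def inv_field_def qmult_def qunit_def inner_prod_def inner_complex_def
    using 1 2
    by (simp add: complex_eq_iff) (intro conjI; algebra)
qed

lemma coframe_add:
  "coframe n (p + p') v = coframe n p v + coframe n p' v"
  "coframe n p (v + v') = coframe n p v + coframe n p v'"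
  "coframe n (r *\<^sub>R p) v = r * coframe n p v"
  "coframe n p (r *\<^sub>R v) = r * coframe n p v"
  by (simp_all add: coframe_def inv_field_def qmult_def inner_prod_def inner_complex_def algebra_simps)

lemma inner_qmult_S3:
  assumes "q \<in> S3"
  shows "qmult p q \<bullet> qmult p' q = p \<bullet> p'"
proof -
  have "(Re (fst q))\<^sup>2 + (Im (fst q))\<^sup>2 + (Re (snd q))\<^sup>2 + (Im (snd q))\<^sup>2 = 1"
    using assms by (simp add: S3_iff)
  then show ?thesis
    unfolding qmult_def inner_prod_def inner_complex_def by simp algebra
qed

lemma coframe_inv_field:
  assumes "q \<in> S3"
  shows "coframe l (inv_field m q) (inv_field n q) =
    (if (l, m, n) \<in> {(1, 2, 3), (2, 3, 1), (3, 1, 2)} then 1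
     else if (l, m, n) \<in> {(1, 3, 2), (2, 1, 3), (3, 2, 1)} then -1 else 0)"
proof -
  have "coframe l (inv_field m q) (inv_field n q) = qmult (qunit l) (qunit m) \<bullet> qunit n"
  proof -
    have "inv_field l (inv_field m q) = qmult (qmult (qunit l) (qunit m)) q"
      by (simp add: inv_field_def qmult_def algebra_simps)
    then show ?thesis
      by (simp add: coframe_def inner_qmult_S3[OF assms]) (simp add: inv_field_def inner_qmult_S3[OF assms])
  qed
  then show ?thesis
    using exhaust_3[of l] exhaust_3[of m] exhaust_3[of n]
    by (elim disjE) (simp_all add: qunit_def qmult_def inner_prod_def inner_complex_def)
qed

text \<open>The left side is \<open>de\<^sup>l(v, w)\<close>, as \<open>coframe l q w\<close> is linear in \<open>q\<close>.\<close>

lemma d_coframe: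
  assumes "q \<in> S3" "q \<bullet> v = 0" "q \<bullet> w = 0"
    and "(l, m, n) \<in> {(1, 2, 3), (2, 3, 1), (3, 1, 2)}"
  shows "coframe l v w - coframe l w v =
         2 * (coframe m q v * coframe n q w - coframe m q w * coframe n q v)"
proof -
  define x where "x = (\<lambda>i. coframe i q v)"
  define y where "y = (\<lambda>i. coframe i q w)"
  have v: "v = x 1 *\<^sub>R inv_field 1 q + x 2 *\<^sub>R inv_field 2 q + x 3 *\<^sub>R inv_field 3 q"
    using tangent_expansion[OF assms(1,2)] by (simp add: x_def)
  have w: "w = y 1 *\<^sub>R inv_field 1 q + y 2 *\<^sub>R inv_field 2 q + y 3 *\<^sub>R inv_field 3 q"
    using tangent_expansion[OF assms(1,3)] by (simp add: y_def)
  have cases: "l = 1 \<and> m = 2 \<and> n = 3 \<or> l = 2 \<and> m = 3 \<and> n = 1 \<or> l = 3 \<and> m = 1 \<and> n = 2"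
    using assms(4) by simp
  have "coframe l v w - coframe l w v = 2 * (x m * y n - y m * x n)"
    unfolding v w coframe_add coframe_inv_field[OF assms(1)]
    using cases by (elim disjE) simp_all
  then show ?thesis
    by (simp add: x_def y_def)
qed

lemma istopology_bolt_space:
  "istopology (\<lambda>U. U \<subseteq> pt_class t0 ` cyl_closed t0 T \<and>
     openin (top_of_set (cyl_closed t0 T)) {p \<in> cyl_closed t0 T. pt_class t0 p \<in> U})"
  (is "istopology (\<lambda>U. U \<subseteq> ?X \<and> openin ?Y (?P U))")
proof -
  have 1: "?P (U \<inter> V) = ?P U \<inter> ?P V" for U V
    by auto
  have 2: "?P (\<Union>K) = \<Union>(?P ` K)" for K
    by auto
  show ?thesis
    unfolding istopology_def 1 2 by (auto intro!: openin_Int openin_Union)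
qed

lemma onframe_has_derivative:
  "(onframe a1 a2 n has_derivative onframe a1 a2 n) (at q)"
proof -
  have "linear (onframe a1 a2 n)"
    by (rule linearI)
      (auto simp: onframe_def inv_field_def qmult_def algebra_simps scaleR_add_right complex_eq_iff)
  then show ?thesis
    by (simp add: linear_imp_has_derivative)
qed

lemma lie_bracket_onframe:
  "lie_bracket (onframe a1 a2 i) (onframe a1 a2 j) q =
     onframe a1 a2 j (onframe a1 a2 i q) - onframe a1 a2 i (onframe a1 a2 j q)"
  unfolding lie_bracket_def
  by (simp add: frechet_derivative_at[OF onframe_has_derivative, symmetric])

lemma struct_coeff_eq:
  assumes "q \<in> S3" "a1 \<noteq> 0" "a2 \<noteq> 0"
  shows "struct_coeff a1 a2 q i j k =
    (let s = (\<lambda>n :: 3. if n = 1 then a1 else a2); r = 2 * s k / (s i * s j) in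
     if (i, j, k) \<in> {(1, 2, 3), (2, 3, 1), (3, 1, 2)} then - r
     else if (i, j, k) \<in> {(1, 3, 2), (2, 1, 3), (3, 2, 1)} then r else 0)"
proof -
  have cf: "coframe n q (inv_field i (inv_field j q)) = qunit n \<bullet> qmult (qunit i) (qunit j)" for n i j
  proof -
    have "inv_field i (inv_field j q) = qmult (qmult (qunit i) (qunit j)) q"
      by (simp add: inv_field_def qmult_def algebra_simps)
    then show ?thesis
      by (simp add: coframe_def inv_field_def inner_qmult_S3[OF assms(1)])
  qed
  have sc: "inv_field n (r *\<^sub>R p) = r *\<^sub>R inv_field n p" for n r p
    by (simp add: inv_field_def qmult_def algebra_simps)
  have co: "coframe n p (v - v') = coframe n p v - coframe n p v'" for n p v v'
    by (simp add: coframe_def inner_diff_right)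
  show ?thesis
    unfolding struct_coeff_def lie_bracket_onframe gbar_def onframe_def sc co coframe_add cf
      coframe_dual[OF assms(1)]
    using exhaust_3[of i] exhaust_3[of j] exhaust_3[of k] assms
    by (elim disjE) (simp_all add: qunit_def qmult_def inner_prod_def inner_complex_def
        field_simps power2_eq_square)
qed

lemma Ric_diag:
  assumes "q \<in> S3" "a1 \<noteq> 0" "a2 \<noteq> 0"
  shows "Ric a1 a2 q $ 1 $ 1 = 4 * (a1\<^sup>2 / a2 ^ 4)"
    and "Ric a1 a2 q $ 2 $ 2 = 4 / a2\<^sup>2 * (2 - a1\<^sup>2 / a2\<^sup>2)"
    and "Ric a1 a2 q $ 3 $ 3 = 4 / a2\<^sup>2 * (2 - a1\<^sup>2 / a2\<^sup>2)"
    and "i \<noteq> j \<Longrightarrow> Ric a1 a2 q $ i $ j = 0"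
proof -
  show "Ric a1 a2 q $ 1 $ 1 = 4 * (a1\<^sup>2 / a2 ^ 4)"
    using assms(2,3) unfolding Ric_def conn_coeff_def struct_coeff_eq[OF assms] Let_def
    by (simp add: sum_3) (simp add: field_simps power2_eq_square power4_eq_xxxx)
  show "Ric a1 a2 q $ 2 $ 2 = 4 / a2\<^sup>2 * (2 - a1\<^sup>2 / a2\<^sup>2)"
    using assms(2,3) unfolding Ric_def conn_coeff_def struct_coeff_eq[OF assms] Let_def
    by (simp add: sum_3) (simp add: field_simps power2_eq_square)
  show "Ric a1 a2 q $ 3 $ 3 = 4 / a2\<^sup>2 * (2 - a1\<^sup>2 / a2\<^sup>2)"
    using assms(2,3) unfolding Ric_def conn_coeff_def struct_coeff_eq[OF assms] Let_def
    by (simp add: sum_3) (simp add: field_simps power2_eq_square)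
  show "Ric a1 a2 q $ i $ j = 0" if "i \<noteq> j"
    using that exhaust_3[of i] exhaust_3[of j]
    unfolding Ric_def conn_coeff_def struct_coeff_eq[OF assms] Let_def
    by (elim disjE) (simp_all add: sum_3)
qed

end

theory Submission
  imports Defs
begin

text \<open>Along the flow, positivity and the non-degeneracy of the Ricci matrix propagate from \<open>t = 0\<close>, so
  the equation is \<open>A\<^sub>1' = c (2 - A\<^sub>1\<^sup>2 / A\<^sub>2\<^sup>2)\<close>, \<open>A\<^sub>2' = c A\<^sub>1 / A\<^sub>2\<close>, and the slope \<open>2\<close> at the origin forces
  \<open>c = 1\<close>. The quantity \<open>A\<^sub>1\<^sup>2 A\<^sub>2\<^sup>2 - A\<^sub>2\<^sup>4 = - a\<^sup>4\<close> is conserved, hence \<open>A\<^sub>1 = A\<^sub>2 sqrt (1 - (a / A\<^sub>2)\<^sup>4)\<close> and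
  \<open>A\<^sub>2' = sqrt (1 - (a / A\<^sub>2)\<^sup>4)\<close>: the radius \<open>r = A\<^sub>2(t)\<close> turns \<open>g\<close> into the Eguchi--Hanson metric.
  The distance \<open>\<tau>(r)\<close> from the bolt satisfies \<open>\<tau>(A\<^sub>2(t)) = t\<close>, so every solution is the restriction
  of a single one defined for all time, and by maximality \<open>A\<^sub>2\<close> maps onto \<open>[a, \<infinity>)\<close> with inverse \<open>\<tau>\<close>.\<close>

section \<open>Smoothness of radial maps\<close>

text \<open>Smoothness of solutions that are not given in closed form comes from exhibiting finitely many
  functions whose derivatives are polynomials in them.\<close>

inductive_set fun_ring :: "(real \<Rightarrow> real) set \<Rightarrow> (real \<Rightarrow> real) set" for G where
  gen: "g \<in> G \<Longrightarrow> g \<in> fun_ring G"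
| const: "(\<lambda>_. c) \<in> fun_ring G"
| add: "f \<in> fun_ring G \<Longrightarrow> g \<in> fun_ring G \<Longrightarrow> (\<lambda>t. f t + g t) \<in> fun_ring G"
| mult: "f \<in> fun_ring G \<Longrightarrow> g \<in> fun_ring G \<Longrightarrow> (\<lambda>t. f t * g t) \<in> fun_ring G"

lemma fun_ring_power: "f \<in> fun_ring G \<Longrightarrow> (\<lambda>t. f t ^ n) \<in> fun_ring G"
  by (induction n) (auto intro: fun_ring.intros)

text \<open>The sum and product rules reduce closure under differentiation to the generators. A ring
  closed in this sense serves as the family \<open>P\<close> in the smoothness lemmas below.\<close>

lemma fun_ring_deriv:
  assumes gen: "\<And>g. g \<in> G \<Longrightarrow> \<exists>g'\<in>fun_ring G. \<forall>t\<in>I. (g has_real_derivative g' t) (at t)"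
    and "f \<in> fun_ring G"
  shows "\<exists>f'\<in>fun_ring G. \<forall>t\<in>I. (f has_real_derivative f' t) (at t)"
  using assms(2)
proof induction
  case (gen g)
  then show ?case by (rule assms(1))
next
  case (const c)
  show ?case by (rule bexI[OF _ fun_ring.const[of 0]]) simp
next
  case (add f g)
  then obtain f' g' where "f' \<in> fun_ring G" "g' \<in> fun_ring G"
    and "\<forall>t\<in>I. (f has_real_derivative f' t) (at t)" "\<forall>t\<in>I. (g has_real_derivative g' t) (at t)"
    by blast
  then show ?case
    by (intro bexI[where x = "\<lambda>t. f' t + g' t"]) (auto intro: fun_ring.intros DERIV_add)
next
  case (mult f g)
  then obtain f' g' where "f' \<in> fun_ring G" "g' \<in> fun_ring G"
    and "\<forall>t\<in>I. (f has_real_derivative f' t) (at t)" "\<forall>t\<in>I. (g has_real_derivative g' t) (at t)"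
    by blast
  with mult(1,2) show ?case
    by (intro bexI[where x = "\<lambda>t. f' t * g t + g' t * f t"]) (auto intro: fun_ring.intros DERIV_mult)
qed

text \<open>Openness of \<open>U\<close> matters: a Frechet derivative at a point of
  \<open>U\<close> depends only on nearby values, which lie in \<open>U\<close>, so agreement on
  \<open>U\<close> passes to derivatives of every order.\<close>

lemma Ck_on_cong:
  assumes "open U" "\<And>x. x \<in> U \<Longrightarrow> f x = g x" "Ck_on n U f"
  shows "Ck_on n U g"
  using assms(2,3)
proof (induction n arbitrary: f g)
  case 0
  then show ?case by (simp cong: continuous_on_cong)
next
  case (Suc n)
  have deriv: "(g has_derivative frechet_derivative f (at x)) (at x)" if "x \<in> U" for x
  proof (rule has_derivative_transform_within_open[OF _ assms(1) that])
    show "(f has_derivative frechet_derivative f (at x)) (at x)"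
      using Suc.prems(2) that by (simp add: frechet_derivative_works[symmetric])
  qed (rule Suc.prems(1))
  have "Ck_on n U (\<lambda>x. frechet_derivative g (at x) v)" for v
  proof (rule Suc.IH)
    show "Ck_on n U (\<lambda>x. frechet_derivative f (at x) v)"
      using Suc.prems by simp
    show "frechet_derivative f (at x) v = frechet_derivative g (at x) v" if "x \<in> U" for x
      using frechet_derivative_at[OF deriv[OF that]] by simp
  qed
  then show ?case
    using deriv by (auto simp: differentiable_def)
qed

lemma radial_has_derivative:
  fixes f :: "real \<Rightarrow> real" and x :: "real \<times> 'b::real_normed_vector"
  assumes "(f has_real_derivative f') (at (fst x))"
  shows "((\<lambda>x. f (fst x)) has_derivative (\<lambda>v. f' * fst v)) (at x)"
  using has_derivative_compose[OF has_derivative_fst[OF has_derivative_ident]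
      assms[unfolded has_field_derivative_def]] .

text \<open>A directional derivative of \<open>(f t * c, w)\<close> is again of this shape, with
  \<open>f'\<close> from \<open>P\<close>, a new constant \<open>fst v * c\<close>, and
  \<open>0\<close> for \<open>w\<close>. The parameters \<open>c\<close> and \<open>w\<close> are
  there to close the induction.\<close>

lemma Ck_on_radial:
  fixes I :: "real set"
  assumes "open I"
    and P: "\<And>f. f \<in> P \<Longrightarrow> \<exists>f'\<in>P. \<forall>t\<in>I. (f has_real_derivative f' t) (at t)"
    and "f \<in> P"
  shows "Ck_on n (I \<times> UNIV) (\<lambda>x :: real \<times> 'b::real_normed_vector. (f (fst x) * c, w :: 'c::real_normed_vector))"
  using assms(3)
proof (induction n arbitrary: f c w)
  case 0
  obtain f' where f': "\<And>t. t \<in> I \<Longrightarrow> (f has_real_derivative f' t) (at t)"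
    using P[OF 0] by blast
  then have "continuous_on I f"
    by (auto intro!: continuous_at_imp_continuous_on intro: DERIV_isCont)
  then show ?case
    by (auto intro!: continuous_intros continuous_on_compose2[of I f])
next
  case (Suc n)
  obtain f' where f': "f' \<in> P" "\<And>t. t \<in> I \<Longrightarrow> (f has_real_derivative f' t) (at t)"
    using P[OF Suc.prems] by blast
  have d: "((\<lambda>x :: real \<times> 'b. (f (fst x) * c, w)) has_derivative (\<lambda>v. (f' (fst x) * fst v * c, 0))) (at x)"
    if "x \<in> I \<times> UNIV" for x
    using that f'(2)[of "fst x"]
    by (auto intro!: has_derivative_Pair has_derivative_mult_left radial_has_derivative)
  have "Ck_on n (I \<times> UNIV) (\<lambda>x :: real \<times> 'b.
      frechet_derivative (\<lambda>x. (f (fst x) * c, w)) (at x) v)" for v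
    using Suc.IH[OF f'(1), of "fst v * c" 0]
    by (rule Ck_on_cong[rotated 2])
      (auto simp: open_Times assms(1) frechet_derivative_at[OF d, symmetric] mult.assoc)
  then show ?case
    using d unfolding Ck_on.simps differentiable_def by blast
qed

text \<open>The map is linear in the second component, so its first derivative in direction
  \<open>v\<close> is radial: it has the shape of \<open>Ck_on_radial\<close> with
  \<open>c = fst v\<close> and \<open>w = snd v\<close>.\<close>

lemma smooth_map_on_radial:
  fixes I :: "real set"
  assumes "open I"
    and P: "\<And>f. f \<in> P \<Longrightarrow> \<exists>f'\<in>P. \<forall>t\<in>I. (f has_real_derivative f' t) (at t)"
    and "f \<in> P"
  shows "smooth_map_on (I \<times> UNIV) (\<lambda>x :: real \<times> 'b::real_normed_vector. (f (fst x), snd x))"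
  unfolding smooth_map_on_def
proof
  fix n
  obtain f' where f': "f' \<in> P" "\<And>t. t \<in> I \<Longrightarrow> (f has_real_derivative f' t) (at t)"
    using P[OF assms(3)] by blast
  have d: "((\<lambda>x :: real \<times> 'b. (f (fst x), snd x)) has_derivative (\<lambda>v. (f' (fst x) * fst v, snd v))) (at x)"
    if "x \<in> I \<times> UNIV" for x
    using that f'(2)[of "fst x"]
    by (auto intro!: has_derivative_Pair radial_has_derivative has_derivative_snd)
  have diff: "(\<lambda>x :: real \<times> 'b. (f (fst x), snd x)) differentiable (at x)" if "x \<in> I \<times> UNIV" for x
    using d[OF that] unfolding differentiable_def by blast
  show "Ck_on n (I \<times> UNIV) (\<lambda>x :: real \<times> 'b. (f (fst x), snd x))"
  proof (cases n)
    case 0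
    show ?thesis
      unfolding 0 Ck_on.simps
      by (intro continuous_at_imp_continuous_on ballI differentiable_imp_continuous_within diff)
  next
    case (Suc m)
    have "Ck_on m (I \<times> UNIV) (\<lambda>x :: real \<times> 'b.
        frechet_derivative (\<lambda>x. (f (fst x), snd x)) (at x) v)" for v
      using Ck_on_radial[OF assms(1) P f'(1), of m "fst v" "snd v"]
      by (rule Ck_on_cong[rotated 2])
        (auto simp: open_Times assms(1) frechet_derivative_at[OF d, symmetric])
    then show ?thesis
      unfolding Suc Ck_on.simps using diff by blast
  qed
qed

section \<open>Radial maps of cylinders with a bolt\<close>

text \<open>Both kinds of class depend on the spherical component alone, which a radial map fixes;
  the hypothesis ensures that collapsed circles correspond to collapsed circles and antipodal pairs
  to antipodal pairs.\<close>

lemma pt_class_radial_image: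
  assumes "h (fst p) = s0 \<longleftrightarrow> fst p = t0"
  shows "(\<lambda>x. (h (fst x), snd x)) ` pt_class t0 p = pt_class s0 (h (fst p), snd p)"
  using assms by (auto simp: pt_class_def image_iff split: prod.splits)

lemma openin_bolt_space:
  "openin (bolt_space t0 T) U \<longleftrightarrow> U \<subseteq> pt_class t0 ` cyl_closed t0 T \<and>
     openin (top_of_set (cyl_closed t0 T)) {p \<in> cyl_closed t0 T. pt_class t0 p \<in> U}"
  unfolding bolt_space_def by (simp only: topology_inverse'[OF istopology_bolt_space])

lemma topspace_bolt_space: "topspace (bolt_space t0 T) = pt_class t0 ` cyl_closed t0 T"
proof
  show "topspace (bolt_space t0 T) \<subseteq> pt_class t0 ` cyl_closed t0 T"
    using openin_bolt_space openin_topspace by blast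
  have "{p \<in> cyl_closed t0 T. pt_class t0 p \<in> pt_class t0 ` cyl_closed t0 T} = cyl_closed t0 T"
    by blast
  then have "openin (bolt_space t0 T) (pt_class t0 ` cyl_closed t0 T)"
    by (simp add: openin_bolt_space)
  then show "pt_class t0 ` cyl_closed t0 T \<subseteq> topspace (bolt_space t0 T)"
    by (rule openin_subset)
qed

text \<open>Continuity descends through the quotient: the radial map carries classes onto classes,
  so the preimage of an open set of classes, lifted to the cylinder, is the preimage of a lifted
  open set.\<close>

lemma continuous_map_bolt_space_radial:
  assumes cont: "continuous_on {t0..} h"
    and "h t0 = s0" "\<And>t. t > t0 \<Longrightarrow> h t > s0"
  shows "continuous_map (bolt_space t0 \<infinity>) (bolt_space s0 \<infinity>) ((`) (\<lambda>x. (h (fst x), snd x)))"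
    (is "continuous_map _ _ ((`) ?\<phi>)")
proof -
  let ?X = "cyl_closed t0 \<infinity>" and ?Y = "cyl_closed s0 \<infinity>"
  have X: "?X = {t0..} \<times> S3" and Y: "?Y = {s0..} \<times> S3"
    by (auto simp: cyl_closed_def)
  have \<phi>: "?\<phi> p \<in> ?Y" "?\<phi> ` pt_class t0 p = pt_class s0 (?\<phi> p)" if "p \<in> ?X" for p
  proof -
    have "fst p = t0 \<or> fst p > t0"
      using that by (auto simp: X)
    then have "h (fst p) \<ge> s0" "h (fst p) = s0 \<longleftrightarrow> fst p = t0"
      using assms(2) assms(3)[of "fst p"] by auto
    then show "?\<phi> p \<in> ?Y" "?\<phi> ` pt_class t0 p = pt_class s0 (?\<phi> p)"
      using that pt_class_radial_image[of h p s0 t0] by (auto simp: X Y)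
  qed
  have \<phi>_cont: "continuous_on ?X ?\<phi>"
    unfolding X by (auto intro!: continuous_intros continuous_on_compose2[OF cont])
  show ?thesis
    unfolding continuous_map_def
  proof (intro conjI allI impI)
    show "(`) ?\<phi> \<in> topspace (bolt_space t0 \<infinity>) \<rightarrow> topspace (bolt_space s0 \<infinity>)"
      unfolding topspace_bolt_space using \<phi> by fastforce
    fix U assume U: "openin (bolt_space s0 \<infinity>) U"
    let ?V = "{C \<in> topspace (bolt_space t0 \<infinity>). ?\<phi> ` C \<in> U}"
    have "{p \<in> ?X. pt_class t0 p \<in> ?V} = ?X \<inter> ?\<phi> -` {p \<in> ?Y. pt_class s0 p \<in> U}"
      using \<phi> by (auto simp: topspace_bolt_space)
    moreover have "openin (top_of_set ?X) (?X \<inter> ?\<phi> -` {p \<in> ?Y. pt_class s0 p \<in> U})"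
      using U \<phi>(1)
      by (intro continuous_openin_preimage[OF \<phi>_cont, of ?Y]) (auto simp: openin_bolt_space)
    ultimately show "openin (bolt_space t0 \<infinity>) ?V"
      by (auto simp: openin_bolt_space topspace_bolt_space)
  qed
qed

text \<open>One formula covers the map on the whole open cylinder, so the same local lift works at
  every point. Its derivative scales the radial component by \<open>h'\<close> and fixes the
  spherical one, which leaves a pointwise identity of metrics to check.\<close>

lemma preserves_metric_radial:
  assumes smooth: "smooth_map_on ({t0<..} \<times> UNIV) (\<lambda>x :: real \<times> quat. (h (fst x), snd x))"
    and gt: "\<And>t. t > t0 \<Longrightarrow> h t > s0"
    and deriv: "\<And>t. t > t0 \<Longrightarrow> (h has_real_derivative h' t) (at t)"
    and metric: "\<And>t q \<tau> v \<sigma> w. t > t0 \<Longrightarrow> H (h t, q) (h' t * \<tau>, v) (h' t * \<sigma>, w) = G (t, q) (\<tau>, v) (\<sigma>, w)"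
  shows "preserves_metric ((`) (\<lambda>x. (h (fst x), snd x))) t0 \<infinity> G s0 \<infinity> H"
  unfolding preserves_metric_def
proof
  fix p :: "real \<times> quat"
  assume p: "p \<in> cyl_open t0 \<infinity>"
  let ?\<phi> = "\<lambda>x :: real \<times> quat. (h (fst x), snd x)"
  have d: "frechet_derivative ?\<phi> (at x) = (\<lambda>v. (h' (fst x) * fst v, snd v))" if "fst x > t0" for x
    by (rule frechet_derivative_at[symmetric])
      (intro has_derivative_Pair radial_has_derivative has_derivative_snd has_derivative_ident deriv that)
  have "?\<phi> x \<in> cyl_open s0 \<infinity> \<and> ?\<phi> ` pt_class t0 x = pt_class s0 (?\<phi> x) \<and>
      (\<forall>v w. H (?\<phi> x) (frechet_derivative ?\<phi> (at x) v) (frechet_derivative ?\<phi> (at x) w) = G x v w)"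
    if "x \<in> cyl_open t0 \<infinity>" for x
  proof -
    have x: "fst x > t0" "snd x \<in> S3"
      using that by (auto simp: cyl_open_def)
    have "?\<phi> ` pt_class t0 x = pt_class s0 (?\<phi> x)"
      using pt_class_radial_image[of h x s0 t0] gt[OF x(1)] x(1) by simp
    moreover have "?\<phi> x \<in> cyl_open s0 \<infinity>"
      using gt[OF x(1)] x(2) by (simp add: cyl_open_def)
    moreover have "H (?\<phi> x) (h' (fst x) * fst v, snd v) (h' (fst x) * fst w, snd w) = G x v w" for v w
      using metric[OF x(1), of "snd x" "fst v" "snd v" "fst w" "snd w"] by simp
    ultimately show ?thesis
      by (simp add: d[OF x(1)])
  qed
  moreover have "open ({t0<..} \<times> (UNIV :: quat set))" "p \<in> {t0<..} \<times> UNIV"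
    using p by (auto simp: open_Times cyl_open_def)
  ultimately show "\<exists>U \<phi>. open U \<and> p \<in> U \<and> smooth_map_on U \<phi> \<and>
        (\<forall>x \<in> U \<inter> cyl_open t0 \<infinity>.
           \<phi> x \<in> cyl_open s0 \<infinity> \<and> ?\<phi> ` pt_class t0 x = pt_class s0 (\<phi> x) \<and>
           (\<forall>v w. snd x \<bullet> snd v = 0 \<and> snd x \<bullet> snd w = 0 \<longrightarrow>
              H (\<phi> x) (frechet_derivative \<phi> (at x) v) (frechet_derivative \<phi> (at x) w) = G x v w))"
    using smooth by blast
qed

section \<open>The flow equations\<close>

lemma gbar_onframe:
  assumes "q \<in> S3"
  shows "gbar a1 a2 q (onframe b1 b2 i q) (onframe b1 b2 j q) =
    (if i = j then if i = 1 then a1\<^sup>2 / b1\<^sup>2 else a2\<^sup>2 / b2\<^sup>2 else 0)"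
  using exhaust_3[of i] exhaust_3[of j]
  by (elim disjE)
    (simp_all add: gbar_def onframe_def coframe_add coframe_dual[OF assms] power2_eq_square)

text \<open>\<open>matrix_inv\<close> is a Hilbert choice: the diagonal matrix of reciprocals first
  witnesses that a two-sided inverse exists, and uniqueness of inverses then identifies it with the
  chosen one.\<close>

lemma matrix_inv_diagonal:
  fixes M :: "'a::field ^ 'n ^ 'n"
  assumes "\<And>i j. i \<noteq> j \<Longrightarrow> M $ i $ j = 0" "\<And>i. M $ i $ i \<noteq> 0"
  shows "matrix_inv M = (\<chi> i j. if i = j then 1 / M $ i $ i else 0)" (is "_ = ?N")
proof -
  have eq: "M $ i $ k * ?N $ k $ j = (if k = i then if i = j then 1 else 0 else 0)"
    "?N $ i $ k * M $ k $ j = (if k = i then if i = j then 1 else 0 else 0)" for i j k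
    using assms by auto
  have N: "M ** ?N = mat 1" "?N ** M = mat 1"
    unfolding matrix_matrix_mult_def eq mat_def by (simp_all add: vec_eq_iff)
  have left: "M ** matrix_inv M = mat 1 \<and> matrix_inv M ** M = mat 1"
    unfolding matrix_inv_def by (rule someI[of _ ?N]) (simp add: N)
  have "matrix_inv M = matrix_inv M ** (M ** ?N)"
    by (simp add: N)
  also have "\<dots> = ?N"
    by (simp add: matrix_mul_assoc left)
  finally show ?thesis .
qed

text \<open>The determinant is a perfect square, and the sign hypotheses select its positive root.
  The entries are written as \<open>2 * D / f\<close>, the logarithmic derivative of a square
  \<open>f\<^sup>2\<close> with \<open>f' = D\<close>.\<close>

lemma Ric_flow_rhs:
  assumes "q \<in> S3" "a1 > 0" "a2 > 0" "a1\<^sup>2 < 2 * a2\<^sup>2"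
  shows "invertible (Ric a1 a2 q)"
    and "c * sqrt (det (Ric a1 a2 q)) * matrix_inv (Ric a1 a2 q) $ i $ j =
      (if i = j then if i = 1 then 2 * (c * (2 - a1\<^sup>2 / a2\<^sup>2)) / a1 else 2 * (c * (a1 / a2)) / a2 else 0)"
proof -
  \<comment> \<open>The double eigenvalue of the Ricci matrix.\<close>
  define R where "R = 4 / a2\<^sup>2 * (2 - a1\<^sup>2 / a2\<^sup>2)"
  have R: "R > 0"
    using assms by (simp add: R_def field_simps)
  note d = Ric_diag[of q a1 a2, folded R_def]
  have diag: "Ric a1 a2 q $ i $ i = (if i = 1 then 4 * (a1\<^sup>2 / a2 ^ 4) else R)" for i
    using exhaust_3[of i] d(1-3) assms(1-3) by auto
  have det: "det (Ric a1 a2 q) = (2 * a1 / a2\<^sup>2 * R)\<^sup>2"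
  proof -
    have "det (Ric a1 a2 q) = (\<Prod>i\<in>UNIV. Ric a1 a2 q $ i $ i)"
      using assms(1-3) by (intro det_diagonal d(4)) auto
    also have "\<dots> = 4 * (a1\<^sup>2 / a2 ^ 4) * (R * R)"
      unfolding diag UNIV_3 by simp
    also have "\<dots> = (2 * a1 / a2\<^sup>2 * R)\<^sup>2"
      by (simp add: power_mult_distrib power_divide power2_eq_square[of R])
    finally show ?thesis .
  qed
  then show "invertible (Ric a1 a2 q)"
    using assms R by (simp add: invertible_det_nz)
  have sqrt: "sqrt (det (Ric a1 a2 q)) = 2 * a1 / a2\<^sup>2 * R"
    using assms R by (simp add: det)
  have inv: "matrix_inv (Ric a1 a2 q) = (\<chi> i j. if i = j then 1 / Ric a1 a2 q $ i $ i else 0)"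
    using assms R by (intro matrix_inv_diagonal) (auto simp: d(4) diag)
  show "c * sqrt (det (Ric a1 a2 q)) * matrix_inv (Ric a1 a2 q) $ i $ j =
      (if i = j then if i = 1 then 2 * (c * (2 - a1\<^sup>2 / a2\<^sup>2)) / a1 else 2 * (c * (a1 / a2)) / a2 else 0)"
  proof (cases "i = 1")
    case True
    have "c * (2 * a1 / a2\<^sup>2 * R) * (1 / (4 * (a1\<^sup>2 / a2 ^ 4))) = 2 * (c * (2 - a1\<^sup>2 / a2\<^sup>2)) / a1"
      using assms(2,3) by (simp add: R_def field_simps power2_eq_square power4_eq_xxxx)
    then show ?thesis
      using True by (simp add: sqrt inv diag)
  next
    case False
    then show ?thesis
      using assms R by (simp add: sqrt inv diag power2_eq_square)
  qed
qed

text \<open>The double eigenvalue is proportional to \<open>2 * a2\<^sup>2 - a1\<^sup>2\<close>.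
  Invertibility thus gives a barrier that a solution cannot cross.\<close>

lemma Ric_invertible_imp:
  assumes "invertible (Ric a1 a2 q)" "q \<in> S3" "a1 \<noteq> 0" "a2 \<noteq> 0"
  shows "a1\<^sup>2 \<noteq> 2 * a2\<^sup>2"
proof
  assume "a1\<^sup>2 = 2 * a2\<^sup>2"
  then have "Ric a1 a2 q $ 2 $ 2 = 0"
    using assms(2-4) by (simp add: Ric_diag)
  moreover have "det (Ric a1 a2 q) = (\<Prod>i\<in>UNIV. Ric a1 a2 q $ i $ i)"
    using assms(2-4) by (intro det_diagonal Ric_diag(4))
  ultimately have "det (Ric a1 a2 q) = 0"
    unfolding UNIV_3 by simp
  then show False
    using assms(1) by (simp add: invertible_det_nz)
qed

text \<open>The flow differentiates squares only; positivity lets \<open>f\<close> be recovered as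
  \<open>f t\<close> times the square root of the ratio, which equals 1 at \<open>t\<close>.\<close>

lemma DERIV_from_square_ratio:
  fixes f :: "real \<Rightarrow> real"
  assumes "open U" "t \<in> U" "\<And>s. s \<in> U \<Longrightarrow> f s > 0"
    and "((\<lambda>s. (f s)\<^sup>2 / (f t)\<^sup>2) has_real_derivative 2 * D / f t) (at t)"
  shows "(f has_real_derivative D) (at t)"
proof (rule has_field_derivative_transform_within_open[OF _ assms(1,2)])
  have ft: "f t > 0"
    using assms(2,3) by blast
  define g where "g = (\<lambda>s. (f s)\<^sup>2 / (f t)\<^sup>2)"
  have "(g has_real_derivative 2 * D / f t) (at t)" "g t = 1"
    using assms(4) ft by (auto simp: g_def)
  then have "((\<lambda>s. f t * sqrt (g s)) has_real_derivative D) (at t)"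
    using ft by (auto intro!: derivative_eq_intros simp: field_simps)
  then show "((\<lambda>s. f t * sqrt ((f s)\<^sup>2 / (f t)\<^sup>2)) has_real_derivative D) (at t)"
    by (simp add: g_def)
  show "f t * sqrt ((f s)\<^sup>2 / (f t)\<^sup>2) = f s" if "s \<in> U" for s
    using ft assms(3)[OF that] by (simp add: real_sqrt_divide)
qed

lemma pos_if_nonzero_on_interval:
  fixes f :: "real \<Rightarrow> real"
  assumes "continuous_on {s..t} f" "s \<le> t" "f s > 0" "\<And>x. s \<le> x \<Longrightarrow> x \<le> t \<Longrightarrow> f x \<noteq> 0"
  shows "f t > 0"
proof (rule ccontr)
  assume "\<not> f t > 0"
  then obtain x where "s \<le> x" "x \<le> t" "f x = 0"
    using IVT2'[of f t 0 s] assms(1-3) by force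
  with assms(4) show False by blast
qed

section \<open>The flow as a system of ordinary differential equations\<close>

lemma open_ereal_interval: "open {t. 0 < t \<and> ereal t < T}"
  by (intro open_Collect_conj open_Collect_less continuous_intros continuous_on_ereal)

lemma S3_one: "(1, 0) \<in> S3"
  by (simp add: S3_iff)

text \<open>With the frame frozen at \<open>t\<close>, the diagonal components are square ratios
  whose derivatives at \<open>t\<close> are \<open>2 * A1' / A1\<close> and
  \<open>2 * A2' / A2\<close>. This direction certifies the explicit profile as a solution.\<close>

lemma flow_solution_if_ODE:
  assumes "continuous_on {t. 0 \<le> t \<and> ereal t < T} A1" "continuous_on {t. 0 \<le> t \<and> ereal t < T} A2"
    and pos: "\<And>t. 0 < t \<Longrightarrow> ereal t < T \<Longrightarrow> A1 t > 0 \<and> A2 t > 0 \<and> (A1 t)\<^sup>2 < 2 * (A2 t)\<^sup>2"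
    and A1: "\<And>t. 0 < t \<Longrightarrow> ereal t < T \<Longrightarrow> (A1 has_real_derivative c * (2 - (A1 t)\<^sup>2 / (A2 t)\<^sup>2)) (at t)"
    and A2: "\<And>t. 0 < t \<Longrightarrow> ereal t < T \<Longrightarrow> (A2 has_real_derivative c * (A1 t / A2 t)) (at t)"
  shows "flow_solution c T A1 A2"
  unfolding flow_solution_def
proof (intro conjI allI impI ballI)
  fix t q i j
  assume "0 < t \<and> ereal t < T"
  then have t: "0 < t" "ereal t < T"
    by auto
  note p = pos[OF t]
  show "A1 t \<noteq> 0" "A2 t \<noteq> 0"
    using p by auto
  assume q: "q \<in> S3"
  show "invertible (Ric (A1 t) (A2 t) q)"
    using p q by (simp add: Ric_flow_rhs)
  have "((\<lambda>s. (A1 s)\<^sup>2 / (A1 t)\<^sup>2) has_real_derivative 2 * (c * (2 - (A1 t)\<^sup>2 / (A2 t)\<^sup>2)) / A1 t) (at t)"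
    using p by (auto intro!: derivative_eq_intros A1 t simp: power2_eq_square)
  moreover have "((\<lambda>s. (A2 s)\<^sup>2 / (A2 t)\<^sup>2) has_real_derivative 2 * (c * (A1 t / A2 t)) / A2 t) (at t)"
    using p by (auto intro!: derivative_eq_intros A2 t simp: power2_eq_square)
  ultimately show "((\<lambda>s. gbar (A1 s) (A2 s) q (onframe (A1 t) (A2 t) i q) (onframe (A1 t) (A2 t) j q))
             has_real_derivative
               c * sqrt (det (Ric (A1 t) (A2 t) q)) * matrix_inv (Ric (A1 t) (A2 t) q) $ i $ j)
             (at t)"
    using p by (simp add: gbar_onframe q Ric_flow_rhs(2))
qed (use assms(1,2) in auto)

text \<open>\<open>A1\<close>, \<open>A2\<close> and \<open>2 * A2\<^sup>2 - A1\<^sup>2\<close> do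
  not vanish at positive times, so each keeps its initial sign. Since \<open>A1\<close> starts at 0,
  its sign is read off from the slope there.\<close>

lemma flow_solution_ODE:
  assumes flow: "flow_solution c T A1 A2" and "T > 0"
    and A10: "A1 0 = 0" "(A1 has_real_derivative 2) (at_right 0)" and A20: "A2 0 > 0"
    and t: "0 < t" "ereal t < T"
  shows "A1 t > 0" "A2 t > 0" "(A1 t)\<^sup>2 < 2 * (A2 t)\<^sup>2"
    and "(A1 has_real_derivative c * (2 - (A1 t)\<^sup>2 / (A2 t)\<^sup>2)) (at t)"
    and "(A2 has_real_derivative c * (A1 t / A2 t)) (at t)"
proof -
  define U where "U = {t. 0 < t \<and> ereal t < T}"
  have sub: "x \<in> {t. 0 \<le> t \<and> ereal t < T}" if "0 \<le> x" "x \<le> t" "ereal t < T" for x t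
    using that le_less_trans[of "ereal x" "ereal t" T] by simp
  have cont: "continuous_on {s..t} A1" "continuous_on {s..t} A2" if "0 \<le> s" "ereal t < T" for s t
    using flow that sub unfolding flow_solution_def
    by (auto elim!: continuous_on_subset)
  have nz: "A1 t \<noteq> 0" "A2 t \<noteq> 0" "(A1 t)\<^sup>2 \<noteq> 2 * (A2 t)\<^sup>2" if "t \<in> U" for t
    using flow that Ric_invertible_imp[OF _ S3_one] S3_one unfolding flow_solution_def U_def by blast+
  have pos: "A1 t > 0" "A2 t > 0" "(A1 t)\<^sup>2 < 2 * (A2 t)\<^sup>2" if t: "t \<in> U" for t
  proof -
    have t': "0 < t" "ereal t < T"
      using t by (auto simp: U_def)
    have in_U: "x \<in> U" if "0 < x" "x \<le> t" for x
      using sub[of x t] that t' by (auto simp: U_def)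
    have "((\<lambda>s. A1 s / s) \<longlongrightarrow> 2) (at_right 0)"
      using A10 by (simp add: has_field_derivative_iff)
    then have "eventually (\<lambda>s. A1 s / s > 0) (at_right 0)"
      by (rule order_tendstoD) simp
    then obtain b where b: "b > 0" "\<And>s. 0 < s \<Longrightarrow> s < b \<Longrightarrow> A1 s / s > 0"
      by (auto simp: eventually_at_right_field)
    \<comment> \<open>A starting time that lies where the slope makes \<open>A1\<close> positive and
      does not exceed \<open>t\<close>.\<close>
    define s where "s = min (b / 2) t"
    have s: "0 < s" "s < b" "s \<le> t"
      using b(1) t' by (auto simp: s_def)
    then have "A1 s > 0"
      using b(2)[of s] by (simp add: zero_less_divide_iff)
    then show "A1 t > 0"
    proof (rule pos_if_nonzero_on_interval[of s t, rotated 2])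
      show "continuous_on {s..t} A1"
        using s(1) t'(2) by (intro cont) auto
      show "A1 x \<noteq> 0" if "s \<le> x" "x \<le> t" for x
        using nz(1)[OF in_U, of x] s(1) that by simp
    qed (rule s(3))
    show "A2 t > 0"
    proof (rule pos_if_nonzero_on_interval[of 0 t])
      show "continuous_on {0..t} A2"
        using t'(2) by (intro cont) auto
      \<comment> \<open>The flow gives non-vanishing at positive times only; at \<open>x = 0\<close>
        the initial value is used.\<close>
      show "A2 x \<noteq> 0" if "0 \<le> x" "x \<le> t" for x
        using nz(2)[OF in_U, of x] A20 that by (cases "x = 0") auto
    qed (use t' A20 in auto)
    have "2 * (A2 t)\<^sup>2 - (A1 t)\<^sup>2 > 0"
    proof (rule pos_if_nonzero_on_interval[of 0 t])
      show "continuous_on {0..t} (\<lambda>t. 2 * (A2 t)\<^sup>2 - (A1 t)\<^sup>2)"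
        using t' by (intro continuous_intros cont) auto
      show "2 * (A2 x)\<^sup>2 - (A1 x)\<^sup>2 \<noteq> 0" if "0 \<le> x" "x \<le> t" for x
        using nz(3)[OF in_U, of x] that A10(1) A20 by (cases "x = 0") auto
    qed (use t' A10(1) A20 in auto)
    then show "(A1 t)\<^sup>2 < 2 * (A2 t)\<^sup>2"
      by simp
  qed
  have U: "open U" "t \<in> U"
    using t unfolding U_def by (auto intro: open_ereal_interval)
  then show "A1 t > 0" "A2 t > 0" "(A1 t)\<^sup>2 < 2 * (A2 t)\<^sup>2"
    using pos by auto
  \<comment> \<open>By invariance one point of the sphere is enough. Components 11 and 22 give the
    two equations, and 33 repeats 22.\<close>
  have "((\<lambda>s. gbar (A1 s) (A2 s) (1, 0) (onframe (A1 t) (A2 t) i (1, 0)) (onframe (A1 t) (A2 t) i (1, 0)))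
             has_real_derivative
               c * sqrt (det (Ric (A1 t) (A2 t) (1, 0))) * matrix_inv (Ric (A1 t) (A2 t) (1, 0)) $ i $ i)
             (at t)" for i
    using flow t S3_one unfolding flow_solution_def by blast
  from this[of 1] this[of 2]
  have "((\<lambda>s. (A1 s)\<^sup>2 / (A1 t)\<^sup>2) has_real_derivative 2 * (c * (2 - (A1 t)\<^sup>2 / (A2 t)\<^sup>2)) / A1 t) (at t)"
    "((\<lambda>s. (A2 s)\<^sup>2 / (A2 t)\<^sup>2) has_real_derivative 2 * (c * (A1 t / A2 t)) / A2 t) (at t)"
    by (simp_all add: gbar_onframe S3_one Ric_flow_rhs(2) pos U)
  then show "(A1 has_real_derivative c * (2 - (A1 t)\<^sup>2 / (A2 t)\<^sup>2)) (at t)"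
    "(A2 has_real_derivative c * (A1 t / A2 t)) (at t)"
    using DERIV_from_square_ratio[OF U] pos by blast+
qed

text \<open>As \<open>A1\<close> tends to 0 and \<open>A2\<close> to a positive limit,
  \<open>A1'\<close> tends to \<open>2 * c\<close>; l'Hopital's rule makes this the limit of
  \<open>A1 t / t\<close>, which is the prescribed slope 2.\<close>

lemma flow_coefficient_eq_1:
  assumes flow: "flow_solution c T A1 A2" and "T > 0" "c \<noteq> 0"
    and A10: "A1 0 = 0" "(A1 has_real_derivative 2) (at_right 0)" and A20: "A2 0 > 0"
  shows "c = 1"
proof -
  obtain b where b: "0 < b" "ereal b < T"
    using ereal_dense2[OF \<open>T > 0\<close>] by auto
  have "ereal t < T" if "t < b" for t
    using that b(2) less_trans[of "ereal t" "ereal b" T] by simp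
  then have ev: "eventually (\<lambda>t. 0 < t \<and> ereal t < T) (at_right 0)"
    using b(1) by (auto simp: eventually_at_right_field)
  have "{0..b} \<subseteq> {t. 0 \<le> t \<and> ereal t < T}"
    using b(2) by (auto intro: le_less_trans[of _ "ereal b"])
  then have "continuous_on {0..b} A1" "continuous_on {0..b} A2"
    using flow unfolding flow_solution_def by (blast intro: continuous_on_subset)+
  then have lim: "(A1 \<longlongrightarrow> 0) (at_right 0)" "(A2 \<longlongrightarrow> A2 0) (at_right 0)"
    using continuous_on_Icc_at_rightD[OF _ b(1)] A10(1) by metis+
  note ODE = flow_solution_ODE[OF flow \<open>T > 0\<close> A10 A20]
  \<comment> \<open>The divisor 1 is the derivative of the denominator \<open>t\<close> in
    l'Hopital's rule.\<close>
  have lim': "((\<lambda>t. c * (2 - (A1 t)\<^sup>2 / (A2 t)\<^sup>2) / 1) \<longlongrightarrow> c * (2 - 0\<^sup>2 / (A2 0)\<^sup>2) / 1) (at_right 0)"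
    using A20 by (intro tendsto_intros lim) auto
  have "((\<lambda>t. A1 t / t) \<longlongrightarrow> 2 * c) (at_right 0)"
    using lim' by (intro lhopital_right[where g' = "\<lambda>_. 1", OF lim(1)])
      (auto intro!: eventually_mono[OF ev] ODE(4) tendsto_eq_intros simp: mult.commute)
  moreover have "((\<lambda>t. A1 t / t) \<longlongrightarrow> 2) (at_right 0)"
    using A10 by (simp add: has_field_derivative_iff)
  ultimately have "2 * c = 2"
    using tendsto_unique trivial_limit_at_right_real by blast
  then show ?thesis by simp
qed

section \<open>The Eguchi--Hanson profile\<close>

text \<open>\<open>P\<close> is signed arc length from the bolt in the parameter \<open>s\<close>
  with \<open>r\<^sup>2 = a\<^sup>2 * cosh s\<close>. Its slope is at least \<open>a / 2\<close>, so
  it is a bijection of the line; admitting negative \<open>s\<close> makes 0 an interior point,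
  where the inverse is still differentiable.\<close>

lemma geodesic_parameter_exists:
  assumes "a > 0"
  obtains P Q :: "real \<Rightarrow> real" where "P 0 = 0" "\<And>s. (P has_real_derivative a / 2 * sqrt (cosh s)) (at s)"
    "\<And>s. Q (P s) = s" "\<And>t. P (Q t) = t"
proof -
  let ?f = "\<lambda>s. a / 2 * sqrt (cosh s)"
  have "((\<lambda>s. sqrt (cosh s)) has_real_derivative sinh s / (2 * sqrt (cosh s))) (at s)" for s :: real
    by (auto intro!: derivative_eq_intros simp: field_simps) (use cosh_real_pos[of s] in linarith)
  then have "isCont ?f s" for s
    by (intro continuous_mult continuous_const) (rule DERIV_isCont)
  then obtain P0 where P0: "\<And>s. (P0 has_vector_derivative ?f s) (at s)"
    using einterval_antiderivative[of "-\<infinity>" \<infinity> ?f] by auto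
  define P where "P = (\<lambda>s. P0 s - P0 0)"
  have P: "(P has_real_derivative ?f s) (at s)" for s
    using P0[of s] by (auto simp: P_def has_real_derivative_iff_has_vector_derivative
        intro!: derivative_eq_intros)
  have f: "?f s \<ge> a / 2" for s
    using \<open>a > 0\<close> by (simp add: cosh_real_ge_1)
  have f_pos: "?f s > 0" for s
    using \<open>a > 0\<close> by simp
  have mono: "P s < P t" if "s < t" for s t
    by (rule DERIV_pos_imp_increasing[OF that]) (intro exI conjI, rule P, rule f_pos)
  then have "strict_mono P"
    by (auto simp: strict_mono_def)
  then have inj: "inj P"
    by (rule strict_mono_imp_inj_on)
  have growth: "a / 2 * (t - s) \<le> P t - P s" if "s \<le> t" for s t
  proof -
    have "P s - a / 2 * s \<le> P t - a / 2 * t"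
    proof (rule DERIV_nonneg_imp_nondecreasing[OF that])
      fix x
      have "((\<lambda>x. P x - a / 2 * x) has_real_derivative ?f x - a / 2) (at x)"
        by (auto intro!: derivative_eq_intros P)
      then show "\<exists>y. ((\<lambda>x. P x - a / 2 * x) has_real_derivative y) (at x) \<and> y \<ge> 0"
        using f[of x] by auto
    qed
    then show ?thesis
      by (simp only: right_diff_distrib)
  qed
  have cont: "isCont P s" for s
    using P by (rule DERIV_isCont)
  have "\<exists>s. P s = t" for t
  proof -
    \<comment> \<open>With slope at least \<open>a / 2\<close> and \<open>P 0 = 0\<close>, the
      values at \<open>?b\<close> and \<open>- ?b\<close> enclose \<open>t\<close>.\<close>
    let ?b = "2 * \<bar>t\<bar> / a"
    have "P ?b \<ge> t" "P (- ?b) \<le> t"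
      using growth[of 0 ?b] growth[of "- ?b" 0] \<open>a > 0\<close> by (auto simp: P_def)
    then show ?thesis
      using IVT[of P "- ?b" t ?b] cont \<open>a > 0\<close> by auto
  qed
  then have "surj P"
    by (metis surjI)
  show thesis
  proof (rule that[of P "inv P"])
    show "P 0 = 0"
      by (simp add: P_def)
  qed (rule P, simp_all add: inj \<open>surj P\<close> surj_f_inv_f)
qed

text \<open>The substitution \<open>r\<^sup>2 = a\<^sup>2 cosh s\<close> turns the improper integral for the arc length,
  \<open>dr / sqrt (1 - (a/r)\<^sup>4)\<close>, into the regular one \<open>(a/2) sqrt (cosh s) ds\<close>.\<close>

lemma eguchi_hanson_profile_exists:
  fixes a :: real
  assumes "a > 0"
  obtains B1 B2 \<tau> :: "real \<Rightarrow> real"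
  where "flow_solution 1 \<infinity> B1 B2"
    and "\<And>t. t \<ge> 0 \<Longrightarrow> B1 t = B2 t * sqrt (1 - (a / B2 t) ^ 4)"
    and "continuous_on {a..} \<tau>" "\<tau> a = 0" "\<And>r. r > a \<Longrightarrow> \<tau> r > 0"
    and "\<And>r. r > a \<Longrightarrow> (\<tau> has_real_derivative 1 / sqrt (1 - (a / r) ^ 4)) (at r)"
    and "\<And>r. r \<ge> a \<Longrightarrow> B2 (\<tau> r) = r"
proof -
  obtain P Q :: "real \<Rightarrow> real" where P0: "P 0 = 0"
    and P: "\<And>s. (P has_real_derivative a / 2 * sqrt (cosh s)) (at s)"
    and QP: "\<And>s. Q (P s) = s" and PQ: "\<And>t. P (Q t) = t"
    using geodesic_parameter_exists[OF assms] by blast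
  have P_less: "P s < P t" if "s < t" for s t
    by (rule DERIV_pos_imp_increasing[OF that], intro exI conjI, rule P) (use assms in simp)
  have Q: "(Q has_real_derivative 2 / (a * sqrt (cosh (Q t)))) (at t)" for t
  proof -
    have "(Q has_derivative (*) (2 / (a * sqrt (cosh (Q t))))) (at (P (Q t)))"
    proof (rule has_derivative_inverse_strong[where f = P and S = UNIV])
      show "continuous_on UNIV P"
        using P by (auto intro: continuous_at_imp_continuous_on DERIV_isCont)
      show "(P has_derivative (*) (a / 2 * sqrt (cosh (Q t)))) (at (Q t))"
        using P by (simp add: has_field_derivative_def)
      show "(*) (a / 2 * sqrt (cosh (Q t))) \<circ> (*) (2 / (a * sqrt (cosh (Q t)))) = id"
        using assms by (auto simp: fun_eq_iff)
    qed (auto simp: QP)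
    then show ?thesis
      by (simp add: PQ has_field_derivative_def)
  qed
  have Q_pos: "Q t > 0" if "t > 0" for t
    using P_less[of "Q t" 0] that P0 PQ[of t] by (metis less_asym linorder_less_linear)
  have Q0: "Q 0 = 0"
    using QP[of 0] P0 by simp
  have Q_nonneg: "Q t \<ge> 0" if "t \<ge> 0" for t
    using Q_pos[of t] Q0 that by (cases "t = 0") auto
  \<comment> \<open>With \<open>s = Q t\<close>, \<open>B2\<close> is the radius \<open>r\<close>,
    and \<open>B1\<close> is \<open>r * tanh s\<close>, where
    \<open>tanh s = sqrt (1 - (a / r) ^ 4)\<close> because
    \<open>(a / r) ^ 4 = 1 / (cosh s)\<^sup>2\<close>. The function \<tau> solves for
    \<open>s\<close> and returns the arc length.\<close>
  define B2 where "B2 = (\<lambda>t. a * sqrt (cosh (Q t)))"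
  define B1 where "B1 = (\<lambda>t. B2 t * tanh (Q t))"
  define \<tau> where "\<tau> = (\<lambda>r. P (arcosh (r\<^sup>2 / a\<^sup>2)))"
  have B2_pos: "B2 t > 0" for t
    using assms by (simp add: B2_def)
  have B2_deriv: "(B2 has_real_derivative tanh (Q t)) (at t)" for t
    unfolding B2_def
    using assms by (auto intro!: derivative_eq_intros Q simp: tanh_def field_simps)
      (use cosh_real_pos[of "Q t"] in linarith)
  \<comment> \<open>The derivative of \<open>Q\<close> is \<open>2 / B2\<close>, so the product rule
    gives \<open>tanh\<^sup>2 + 2 * (1 - tanh\<^sup>2)\<close>.\<close>
  have B1_deriv: "(B1 has_real_derivative 2 - (tanh (Q t))\<^sup>2) (at t)" for t
    unfolding B1_def
    using assms B2_pos[of t]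
    by (auto intro!: derivative_eq_intros Q B2_deriv)
      (simp add: B2_def field_simps power2_eq_square)
  have tanh_sq: "(tanh (Q t))\<^sup>2 < 1" for t
    using tanh_real_bounds[of "Q t"] by (auto simp: abs_square_less_1)
  have quotient: "B1 t / B2 t = tanh (Q t)" "(B1 t)\<^sup>2 / (B2 t)\<^sup>2 = (tanh (Q t))\<^sup>2" for t
    using B2_pos[of t] by (simp_all add: B1_def power_mult_distrib)
  have flow: "flow_solution 1 \<infinity> B1 B2"
  proof (rule flow_solution_if_ODE)
    show "continuous_on {t. 0 \<le> t \<and> ereal t < \<infinity>} B1" "continuous_on {t. 0 \<le> t \<and> ereal t < \<infinity>} B2"
      using B1_deriv B2_deriv by (auto intro!: continuous_at_imp_continuous_on intro: DERIV_isCont)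
    fix t :: real assume "0 < t"
    then show "B1 t > 0 \<and> B2 t > 0 \<and> (B1 t)\<^sup>2 < 2 * (B2 t)\<^sup>2"
      using B2_pos[of t] Q_pos[of t] tanh_sq[of t]
      by (auto simp: B1_def power_mult_distrib intro: less_trans[of _ "1 * (B2 t)\<^sup>2"])
    show "(B1 has_real_derivative 1 * (2 - (B1 t)\<^sup>2 / (B2 t)\<^sup>2)) (at t)"
      "(B2 has_real_derivative 1 * (B1 t / B2 t)) (at t)"
      using B1_deriv[of t] B2_deriv[of t] by (simp_all add: quotient)
  qed
  have radial: "B1 t = B2 t * sqrt (1 - (a / B2 t) ^ 4)" if "t \<ge> 0" for t
  proof -
    have "(a / B2 t) ^ 4 = 1 / (cosh (Q t))\<^sup>2"
    proof -
      have "(B2 t)\<^sup>2 = a\<^sup>2 * cosh (Q t)"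
        by (simp add: B2_def power_mult_distrib)
      then have "B2 t ^ 4 = (a\<^sup>2 * cosh (Q t))\<^sup>2"
        by (metis power2_eq_square power4_eq_xxxx mult.assoc)
      then show ?thesis
        using assms by (simp add: power_divide power_mult_distrib)
    qed
    moreover have "1 - 1 / (cosh (Q t))\<^sup>2 = (tanh (Q t))\<^sup>2"
      by (simp add: tanh_def power_divide sinh_square_eq diff_divide_distrib)
    ultimately show ?thesis
      using Q_nonneg[OF that] by (simp add: B1_def)
  qed
  have ratio: "r\<^sup>2 / a\<^sup>2 \<ge> 1" if "r \<ge> a" for r
    using that assms by (simp add: power_mono)
  have ratio': "r\<^sup>2 / a\<^sup>2 > 1" if "r > a" for r
    using that assms by (simp add: power_strict_mono)
  \<comment> \<open>The endpoint \<open>r = a\<close> is included for continuity but not for the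
    derivative: arcosh has infinite slope at 1.\<close>
  have \<tau>_cont: "continuous_on {a..} \<tau>"
  proof -
    have "continuous_on UNIV P"
      using P by (auto intro: continuous_at_imp_continuous_on DERIV_isCont)
    moreover have "continuous_on {a..} (\<lambda>r. arcosh (r\<^sup>2 / a\<^sup>2))"
    proof (rule continuous_on_arcosh')
      show "continuous_on {a..} (\<lambda>r. r\<^sup>2 / a\<^sup>2)"
        using assms by (intro continuous_intros) auto
    qed (simp add: ratio)
    ultimately show ?thesis
      unfolding \<tau>_def by (rule continuous_on_compose2) simp
  qed
  have \<tau>_deriv: "(\<tau> has_real_derivative 1 / sqrt (1 - (a / r) ^ 4)) (at r)" if r: "r > a" for r
  proof -
    have gt: "r\<^sup>2 / a\<^sup>2 > 1"
      using ratio'[OF r] .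
    have "sqrt (1 - (a / r) ^ 4) = sqrt ((r\<^sup>2 / a\<^sup>2)\<^sup>2 - 1) * (a\<^sup>2 / r\<^sup>2)"
    proof -
      have "1 - (a / r) ^ 4 = ((r\<^sup>2 / a\<^sup>2)\<^sup>2 - 1) * (a\<^sup>2 / r\<^sup>2)\<^sup>2"
        using r assms by (simp add: field_simps power2_eq_square power4_eq_xxxx)
      then show ?thesis
        by (simp add: real_sqrt_mult)
    qed
    moreover have "sqrt (r\<^sup>2 / a\<^sup>2) = r / a"
      using r assms by (simp add: real_sqrt_divide)
    moreover have "(\<tau> has_real_derivative
        a / 2 * sqrt (r\<^sup>2 / a\<^sup>2) * (1 / sqrt ((r\<^sup>2 / a\<^sup>2)\<^sup>2 - 1) * (2 * r / a\<^sup>2))) (at r)"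
    proof -
      have sq: "((\<lambda>r. r\<^sup>2 / a\<^sup>2) has_real_derivative 2 * r / a\<^sup>2) (at r)"
        using assms
        by (auto intro!: derivative_eq_intros simp: power2_eq_square power4_eq_xxxx)
      have "((\<lambda>r. arcosh (r\<^sup>2 / a\<^sup>2)) has_real_derivative 1 / sqrt ((r\<^sup>2 / a\<^sup>2)\<^sup>2 - 1) * (2 * r / a\<^sup>2)) (at r)"
        by (rule DERIV_chain2[OF arcosh_real_has_field_derivative[OF gt] sq])
      then show ?thesis
        unfolding \<tau>_def using DERIV_chain2[OF P] gt by fastforce
    qed
    ultimately show ?thesis
      using r assms by (simp add: power2_eq_square)
  qed
  have B2_\<tau>: "B2 (\<tau> r) = r" if "r \<ge> a" for r
    using ratio[OF that] that assms by (simp add: B2_def \<tau>_def QP real_sqrt_divide)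
  have "\<tau> r > 0" if "r > a" for r
    using P_less[OF arcosh_real_strict_mono[OF _ ratio'[OF that]]] by (simp add: \<tau>_def P0)
  moreover have "\<tau> a = 0"
    using assms P0 by (simp add: \<tau>_def)
  ultimately show thesis
    using that[OF flow radial \<tau>_cont _ _ \<tau>_deriv B2_\<tau>] by blast
qed

text \<open>The equations give \<open>(A1 * A2)' = 2 * A2\<close>, so
  \<open>(A1 * A2)\<^sup>2\<close> and \<open>A2 ^ 4\<close> have the same derivative
  \<open>4 * A1 * A2\<^sup>2\<close>. Their difference stays at \<open>- (a ^ 4)\<close>, and
  positivity of \<open>A1 * A2\<close> then forces \<open>A2 > a\<close>.\<close>

lemma flow_conserved_quantity:
  fixes A1 A2 :: "real \<Rightarrow> real"
  assumes "t \<ge> 0" and cont: "continuous_on {0..t} A1" "continuous_on {0..t} A2"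
    and pos: "\<And>s. 0 < s \<Longrightarrow> s \<le> t \<Longrightarrow> A1 s > 0 \<and> A2 s > 0"
    and A1: "\<And>s. 0 < s \<Longrightarrow> s \<le> t \<Longrightarrow> (A1 has_real_derivative 2 - (A1 s)\<^sup>2 / (A2 s)\<^sup>2) (at s)"
    and A2: "\<And>s. 0 < s \<Longrightarrow> s \<le> t \<Longrightarrow> (A2 has_real_derivative A1 s / A2 s) (at s)"
    and init: "A1 0 = 0" "A2 0 = a" "a > 0"
  shows "A1 t = A2 t * sqrt (1 - (a / A2 t) ^ 4)" "t > 0 \<Longrightarrow> A2 t > a"
proof -
  have both: "A1 t = A2 t * sqrt (1 - (a / A2 t) ^ 4) \<and> A2 t > a" if t: "t > 0"
  proof -
    have "(A1 t * A2 t)\<^sup>2 - A2 t ^ 4 = (A1 0 * A2 0)\<^sup>2 - A2 0 ^ 4"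
    proof (rule DERIV_isconst_end[OF t])
      show "continuous_on {0..t} (\<lambda>t. (A1 t * A2 t)\<^sup>2 - A2 t ^ 4)"
        by (intro continuous_intros cont)
      fix s assume s: "0 < s" "s < t"
      then have p: "A1 s > 0" "A2 s > 0"
        using pos[of s] by auto
      show "((\<lambda>t. (A1 t * A2 t)\<^sup>2 - A2 t ^ 4) has_real_derivative 0) (at s)"
        using s p by (auto intro!: derivative_eq_intros A1 A2)
          (simp add: field_simps power2_eq_square power3_eq_cube)
    qed
    then have cons: "(A1 t)\<^sup>2 * (A2 t)\<^sup>2 = A2 t ^ 4 - a ^ 4"
      using init by (simp add: power_mult_distrib)
    have p: "A1 t > 0" "A2 t > 0"
      using pos[of t] t by auto
    then have "a ^ 4 < A2 t ^ 4"
      using cons by (metis diff_gt_0_iff_gt mult_pos_pos zero_less_power)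
    then have gt: "A2 t > a"
      using p by (simp add: power_less_imp_less_base)
    have "1 - (a / A2 t) ^ 4 = (A2 t ^ 4 - a ^ 4) / A2 t ^ 4"
      using p by (simp add: power_divide diff_divide_distrib)
    also have "\<dots> = (A1 t / A2 t)\<^sup>2"
      unfolding cons[symmetric] using p by (simp add: power2_eq_square power4_eq_xxxx)
    finally have "sqrt (1 - (a / A2 t) ^ 4) = A1 t / A2 t"
      using p by (simp add: real_sqrt_unique)
    with p gt show ?thesis by simp
  qed
  then show "t > 0 \<Longrightarrow> A2 t > a" by blast
  show "A1 t = A2 t * sqrt (1 - (a / A2 t) ^ 4)"
    using both assms(1) init by (cases "t = 0") auto
qed

section \<open>The isometry\<close>

text \<open>All points of a class have the same radius; this lets inverse identities valid on a
  half-line be applied inside classes.\<close>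

lemma fst_ge_in_bolt_space:
  assumes "C \<in> topspace (bolt_space t0 T)" "x \<in> C"
  shows "fst x \<ge> t0"
proof -
  obtain p where "p \<in> cyl_closed t0 T" "C = pt_class t0 p"
    using assms(1) unfolding topspace_bolt_space by blast
  moreover from this(2) have "fst x = fst p"
    using assms(2) by (auto simp: pt_class_def split: prod.splits if_splits)
  ultimately show ?thesis
    by (auto simp: cyl_closed_def)
qed

text \<open>The ring generated by \<open>A1\<close>, \<open>A2\<close> and \<open>1 / A2\<close> is
  closed under differentiation, as \<open>(1 / A2)' = - A1 / A2 ^ 3\<close>.\<close>

lemma smooth_map_on_flow_radius:
  fixes A1 A2 :: "real \<Rightarrow> real"
  assumes nz: "\<And>t. t > 0 \<Longrightarrow> A2 t \<noteq> 0"
    and A1: "\<And>t. t > 0 \<Longrightarrow> (A1 has_real_derivative 2 - (A1 t)\<^sup>2 / (A2 t)\<^sup>2) (at t)"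
    and A2: "\<And>t. t > 0 \<Longrightarrow> (A2 has_real_derivative A1 t / A2 t) (at t)"
  shows "smooth_map_on ({0<..} \<times> UNIV) (\<lambda>x :: real \<times> 'b::real_normed_vector. (A2 (fst x), snd x))"
proof -
  define G where "G = {A1, A2, \<lambda>t. 1 / A2 t}"
  have gens: "A1 \<in> fun_ring G" "A2 \<in> fun_ring G" "(\<lambda>t. 1 / A2 t) \<in> fun_ring G"
    by (auto intro: fun_ring.gen simp: G_def)
  note ring = fun_ring.const fun_ring.add fun_ring.mult fun_ring_power gens
  have "\<exists>g'\<in>fun_ring G. \<forall>t\<in>{0<..}. (g has_real_derivative g' t) (at t)" if g: "g \<in> G" for g
  proof -
    consider "g = A1" | "g = A2" | "g = (\<lambda>t. 1 / A2 t)"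
      using g unfolding G_def by blast
    then show ?thesis
    proof cases
      case 1
      have "(\<lambda>t. 2 + (-1) * (A1 t ^ 2 * (1 / A2 t) ^ 2)) \<in> fun_ring G"
        by (intro ring)
      then show ?thesis
        by (rule bexI[rotated]) (use A1 in \<open>auto simp: 1 power_divide\<close>)
    next
      case 2
      have "(\<lambda>t. A1 t * (1 / A2 t)) \<in> fun_ring G"
        by (intro ring)
      then show ?thesis
        by (rule bexI[rotated]) (use A2 in \<open>auto simp: 2\<close>)
    next
      case 3
      have "(\<lambda>t. (-1) * (A1 t * (1 / A2 t) ^ 3)) \<in> fun_ring G"
        by (intro ring)
      moreover have "((\<lambda>t. 1 / A2 t) has_real_derivative (-1) * (A1 t * (1 / A2 t) ^ 3)) (at t)"
        if "t > 0" for t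
        using nz[OF that] by (auto intro!: derivative_eq_intros A2 that)
          (simp add: power3_eq_cube)
      ultimately show ?thesis
        unfolding 3 by (intro bexI) auto
    qed
  qed
  then show ?thesis
    by (rule smooth_map_on_radial[OF open_greaterThan fun_ring_deriv gens(2)])
qed

text \<open>The generators are \<tau>, its derivative \<open>w\<close>, and \<open>1 / r\<close>;
  differentiating the inverse square root gives
  \<open>w' = - 2 * a ^ 4 * w ^ 3 / r ^ 5\<close>.\<close>

lemma smooth_map_on_eguchi_hanson_distance:
  fixes a :: real
  assumes "a > 0"
    and \<tau>: "\<And>r. r > a \<Longrightarrow> (\<tau> has_real_derivative 1 / sqrt (1 - (a / r) ^ 4)) (at r)"
  shows "smooth_map_on ({a<..} \<times> UNIV) (\<lambda>x :: real \<times> 'b::real_normed_vector. (\<tau> (fst x), snd x))"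
proof -
  define w where "w = (\<lambda>r. 1 / sqrt (1 - (a / r) ^ 4))"
  define G where "G = {\<tau>, w, \<lambda>r. 1 / r}"
  have gens: "\<tau> \<in> fun_ring G" "w \<in> fun_ring G" "(\<lambda>r. 1 / r) \<in> fun_ring G"
    by (auto intro: fun_ring.gen simp: G_def)
  note ring = fun_ring.const fun_ring.add fun_ring.mult fun_ring_power gens
  have "\<exists>g'\<in>fun_ring G. \<forall>r\<in>{a<..}. (g has_real_derivative g' r) (at r)" if g: "g \<in> G" for g
  proof -
    consider "g = \<tau>" | "g = w" | "g = (\<lambda>r. 1 / r)"
      using g unfolding G_def by blast
    then show ?thesis
    proof cases
      case 1
      show ?thesis
        by (rule bexI[OF _ gens(2)]) (use \<tau> in \<open>auto simp: 1 w_def\<close>)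
    next
      case 2
      have "(\<lambda>r. (- 2 * a ^ 4) * (w r ^ 3 * (1 / r) ^ 5)) \<in> fun_ring G"
        by (intro ring)
      moreover have "(w has_real_derivative (- 2 * a ^ 4) * (w r ^ 3 * (1 / r) ^ 5)) (at r)"
        if r: "r > a" for r
      proof -
        define u where "u = (\<lambda>r. 1 - (a / r) ^ 4)"
        have u: "u r > 0"
          using r assms(1) by (simp add: u_def power_less_one_iff)
        have "(u has_real_derivative 4 * a ^ 4 * (1 / r) ^ 5) (at r)"
          unfolding u_def using r assms(1)
          by (auto intro!: derivative_eq_intros simp: eval_nat_numeral)
        then have "((\<lambda>r. 1 / sqrt (u r)) has_real_derivative
            - (1 / (2 * sqrt (u r)) * (4 * a ^ 4 * (1 / r) ^ 5)) / (sqrt (u r) * sqrt (u r))) (at r)"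
          using u by (auto intro!: derivative_eq_intros simp: field_simps)
        then show ?thesis
          by (simp add: w_def u_def power3_eq_cube mult_ac)
      qed
      ultimately show ?thesis
        unfolding 2 by (intro bexI) auto
    next
      case 3
      have "(\<lambda>r. (-1) * (1 / r) ^ 2) \<in> fun_ring G"
        by (intro ring)
      moreover have "((\<lambda>r. 1 / r) has_real_derivative (-1) * (1 / r) ^ 2) (at r)" if "r > a" for r
        using that assms(1) by (auto intro!: derivative_eq_intros simp: power2_eq_square)
      ultimately show ?thesis
        unfolding 3 by (intro bexI) auto
    qed
  qed
  then show ?thesis
    by (rule smooth_map_on_radial[OF open_greaterThan fun_ring_deriv gens(1)])
qed

theorem theorem2:
  fixes a c :: real and T :: ereal and A1 A2 :: "real \<Rightarrow> real"
  assumes "a > 0" and "T > 0"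
    and "c \<in> {1 / 2, 1}"
    and "maximal_flow_solution c T A1 A2"
    and "A1 0 = 0"
    and "(A1 has_real_derivative 2) (at_right 0)"
    and "A2 0 = a"
  shows "isometric_metrics 0 T (cyl_metric A1 A2) a \<infinity> (eguchi_hanson a)"
proof -
  have flow: "flow_solution c T A1 A2"
    using assms(4) by (simp add: maximal_flow_solution_def)
  have A20: "A2 0 > 0"
    using assms(1,7) by simp
  have c: "c = 1"
    using flow_coefficient_eq_1[OF flow assms(2) _ assms(5,6) A20] assms(3) by auto
  note ODE = flow_solution_ODE[OF flow assms(2,5,6) A20, unfolded c mult_1]

  \<comment> \<open>Uniqueness and completeness of the solution\<close>
  obtain B1 B2 \<tau> where B: "flow_solution 1 \<infinity> B1 B2"
    and B1: "\<And>t. t \<ge> 0 \<Longrightarrow> B1 t = B2 t * sqrt (1 - (a / B2 t) ^ 4)"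
    and \<tau>_cont: "continuous_on {a..} \<tau>" and \<tau>_a: "\<tau> a = 0" and \<tau>_pos: "\<And>r. r > a \<Longrightarrow> \<tau> r > 0"
    and \<tau>: "\<And>r. r > a \<Longrightarrow> (\<tau> has_real_derivative 1 / sqrt (1 - (a / r) ^ 4)) (at r)"
    and B2_\<tau>: "\<And>r. r \<ge> a \<Longrightarrow> B2 (\<tau> r) = r"
    using eguchi_hanson_profile_exists[OF assms(1)] by metis
  have unique: "A1 t = A2 t * sqrt (1 - (a / A2 t) ^ 4) \<and> (t > 0 \<longrightarrow> A2 t > a) \<and> \<tau> (A2 t) = t"
    if t: "0 \<le> t" "ereal t < T" for t
  proof -
    have less_T: "ereal s < T" if "s \<le> t" for s
      using that t(2) le_less_trans[of "ereal s" "ereal t" T] by simp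
    have sub: "{0..t} \<subseteq> {t. 0 \<le> t \<and> ereal t < T}"
      using less_T by auto
    have cont: "continuous_on {0..t} A1" "continuous_on {0..t} A2"
      using flow sub unfolding flow_solution_def by (blast intro: continuous_on_subset)+
    have radial: "A1 s = A2 s * sqrt (1 - (a / A2 s) ^ 4)" "s > 0 \<Longrightarrow> A2 s > a" if "0 \<le> s" "s \<le> t" for s
    proof -
      have "continuous_on {0..s} A1" "continuous_on {0..s} A2"
        using cont that by (auto elim: continuous_on_subset)
      then show "A1 s = A2 s * sqrt (1 - (a / A2 s) ^ 4)" "s > 0 \<Longrightarrow> A2 s > a"
        using flow_conserved_quantity[of s A1 A2 a] that ODE less_T assms(1,5,7) by simp_all
    qed
    \<comment> \<open>Separation of variables. The equation
      \<open>r' = sqrt (1 - (a / r) ^ 4)\<close> is not Lipschitz at \<open>r = a\<close> and also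
      has the constant solution \<open>a\<close>; the strict bound \<open>A2 s > a\<close> for
      \<open>s > 0\<close> rules that out, and at time 0 continuity suffices.\<close>
    have "\<tau> (A2 t) = t"
    proof (cases "t = 0")
      case True
      then show ?thesis
        by (simp add: assms(7) \<tau>_a)
    next
      case False
      have "\<tau> (A2 t) - t = \<tau> (A2 0) - 0"
      proof (rule DERIV_isconst_end[where f = "\<lambda>t. \<tau> (A2 t) - t" and a = 0 and b = t])
        have "A2 s \<ge> a" if "0 \<le> s" "s \<le> t" for s
          using radial(2)[OF that] assms(7) that by (cases "s = 0") auto
        then show "continuous_on {0..t} (\<lambda>t. \<tau> (A2 t) - t)"
          by (intro continuous_intros continuous_on_compose2[OF \<tau>_cont cont(2)]) auto
        fix s assume s: "0 < s" "s < t"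
        then have gt: "A2 s > a"
          using radial(2) by simp
        have "(a / A2 s) ^ 4 < 1"
          using gt assms(1) by (simp add: power_less_one_iff)
        moreover have "A1 s / A2 s = sqrt (1 - (a / A2 s) ^ 4)"
          using radial(1)[of s] s gt assms(1) by simp
        ultimately have 1: "1 / sqrt (1 - (a / A2 s) ^ 4) * (A1 s / A2 s) = 1"
          by simp
        have "((\<lambda>t. \<tau> (A2 t)) has_real_derivative 1 / sqrt (1 - (a / A2 s) ^ 4) * (A1 s / A2 s)) (at s)"
          using s less_T by (intro DERIV_chain2[where f = \<tau> and g = A2, OF \<tau>[OF gt]] ODE) auto
        then show "((\<lambda>t. \<tau> (A2 t) - t) has_real_derivative 0) (at s)"
          unfolding 1 by (auto intro!: derivative_eq_intros)
      qed (use t False in auto)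
      then show ?thesis
        by (simp add: assms(7) \<tau>_a)
    qed
    with radial t show ?thesis by auto
  qed
  have A2_ge: "A2 t \<ge> a" if "0 \<le> t" "ereal t < T" for t
    using unique[OF that] assms(7) that by (cases "t = 0") auto
  have A_eq_B: "A2 t = B2 t" "A1 t = B1 t" if "0 \<le> t" "ereal t < T" for t
  proof -
    show "A2 t = B2 t"
      using unique[OF that] B2_\<tau>[OF A2_ge[OF that]] by simp
    then show "A1 t = B1 t"
      using unique[OF that] B1[OF that(1)] by simp
  qed
  \<comment> \<open>For finite \<open>T\<close> the pair \<open>B1\<close>, \<open>B2\<close> would
    extend the solution beyond \<open>T\<close>, against maximality.\<close>
  have T: "T = \<infinity>"
  proof (rule ccontr)
    assume "T \<noteq> \<infinity>"
    then have "T < \<infinity>" by simp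
    then show False
      using assms(4) B A_eq_B unfolding maximal_flow_solution_def c by metis
  qed
  have A1: "A1 t = A2 t * sqrt (1 - (a / A2 t) ^ 4)" and \<tau>_A2: "\<tau> (A2 t) = t" if "t \<ge> 0" for t
    using unique[of t] that by (auto simp: T)
  have A2_gt: "A2 t > a" if "t > 0" for t
    using unique[of t] that by (auto simp: T)
  \<comment> \<open>Completeness makes every \<open>\<tau> r\<close> an admissible time, so
    \<open>A2\<close> reaches every radius from \<open>a\<close> on.\<close>
  have A2_\<tau>: "A2 (\<tau> r) = r" if "r \<ge> a" for r
    using A_eq_B(1)[of "\<tau> r"] B2_\<tau>[OF that] \<tau>_pos[of r] \<tau>_a that by (cases "r = a") (auto simp: T)
  have A1_deriv: "(A1 has_real_derivative 2 - (A1 t)\<^sup>2 / (A2 t)\<^sup>2) (at t)"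
    and A2_deriv: "(A2 has_real_derivative A1 t / A2 t) (at t)" if "t > 0" for t
    using ODE[of t] that by (auto simp: T)
  have A2_cont: "continuous_on {0..} A2"
    using flow by (simp add: flow_solution_def T atLeast_def)
  have pos: "1 - (a / r) ^ 4 > 0" if "r > a" for r
    using that assms(1) by (simp add: power_less_one_iff)

  \<comment> \<open>The radius function and its inverse as isometries\<close>
  let ?F = "(`) (\<lambda>x :: real \<times> quat. (A2 (fst x), snd x))"
  let ?F' = "(`) (\<lambda>x :: real \<times> quat. (\<tau> (fst x), snd x))"
  have "homeomorphic_maps (bolt_space 0 \<infinity>) (bolt_space a \<infinity>) ?F ?F'"
    unfolding homeomorphic_maps_def
  proof (intro conjI ballI)
    show "continuous_map (bolt_space 0 \<infinity>) (bolt_space a \<infinity>) ?F"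
      by (rule continuous_map_bolt_space_radial[OF A2_cont assms(7) A2_gt])
    show "continuous_map (bolt_space a \<infinity>) (bolt_space 0 \<infinity>) ?F'"
      by (rule continuous_map_bolt_space_radial[OF \<tau>_cont \<tau>_a \<tau>_pos])
    show "?F' (?F C) = C" if "C \<in> topspace (bolt_space 0 \<infinity>)" for C
    proof -
      have "?F' (?F C) = (\<lambda>x. x) ` C"
        unfolding image_image using fst_ge_in_bolt_space[OF that]
        by (intro image_cong) (simp_all add: \<tau>_A2)
      then show ?thesis by simp
    qed
    show "?F (?F' C) = C" if "C \<in> topspace (bolt_space a \<infinity>)" for C
    proof -
      have "?F (?F' C) = (\<lambda>x. x) ` C"
        unfolding image_image using fst_ge_in_bolt_space[OF that]
        by (intro image_cong) (simp_all add: A2_\<tau>)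
      then show ?thesis by simp
    qed
  qed
  moreover have "preserves_metric ?F 0 \<infinity> (cyl_metric A1 A2) a \<infinity> (eguchi_hanson a)"
  proof (rule preserves_metric_radial[where h' = "\<lambda>t. A1 t / A2 t"])
    show "smooth_map_on ({0<..} \<times> UNIV) (\<lambda>x :: real \<times> quat. (A2 (fst x), snd x))"
      using A2_gt assms(1) by (intro smooth_map_on_flow_radius[OF _ A1_deriv A2_deriv]) force+
    fix t \<rho> \<sigma> :: real and q v w :: quat
    assume t: "t > 0"
    have "A2 t > 0"
      using A2_gt[OF t] assms(1) by simp
    \<comment> \<open>The first identity matches the coefficients of
      \<open>(e\<^sup>1)\<^sup>2\<close>; the second substitutes \<open>dr = A2' dt\<close> with
      \<open>A2'\<^sup>2 = 1 - (a / A2) ^ 4\<close>, so the radial term becomes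
      \<open>dt\<^sup>2\<close>.\<close>
    then have eq: "(A1 t)\<^sup>2 = (A2 t)\<^sup>2 * (1 - (a / A2 t) ^ 4)"
      "inverse (1 - (a / A2 t) ^ 4) * (A1 t / A2 t * \<rho> * (A1 t / A2 t * \<sigma>)) = \<rho> * \<sigma>"
      using A1[of t] t pos[OF A2_gt[OF t]] by (simp_all add: power_mult_distrib)
    show "eguchi_hanson a (A2 t, q) (A1 t / A2 t * \<rho>, v) (A1 t / A2 t * \<sigma>, w) =
        cyl_metric A1 A2 (t, q) (\<rho>, v) (\<sigma>, w)"
      unfolding eguchi_hanson_def cyl_metric_def gbar_def prod.case eq by simp
  qed (fact A2_gt A2_deriv)+
  moreover have "preserves_metric ?F' a \<infinity> (eguchi_hanson a) 0 \<infinity> (cyl_metric A1 A2)"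
  proof (rule preserves_metric_radial[where h' = "\<lambda>r. 1 / sqrt (1 - (a / r) ^ 4)"])
    show "smooth_map_on ({a<..} \<times> UNIV) (\<lambda>x :: real \<times> quat. (\<tau> (fst x), snd x))"
      using assms(1) \<tau> by (rule smooth_map_on_eguchi_hanson_distance)
    fix r \<rho> \<sigma> :: real and q v w :: quat
    assume r: "r > a"
    have radial: "A1 (\<tau> r) = r * sqrt (1 - (a / r) ^ 4)" "A2 (\<tau> r) = r"
      using A1[of "\<tau> r"] A2_\<tau>[of r] \<tau>_pos[OF r] r by simp_all
    \<comment> \<open>The same two comparisons read backwards, with
      \<open>dt = \<tau>' dr\<close>.\<close>
    have sq: "(r * sqrt (1 - (a / r) ^ 4))\<^sup>2 = r\<^sup>2 * (1 - (a / r) ^ 4)"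
      "1 / sqrt (1 - (a / r) ^ 4) * \<rho> * (1 / sqrt (1 - (a / r) ^ 4) * \<sigma>) =
        inverse (1 - (a / r) ^ 4) * (\<rho> * \<sigma>)"
      using pos[OF r] by (simp_all add: power_mult_distrib inverse_eq_divide)
    show "cyl_metric A1 A2 (\<tau> r, q) (1 / sqrt (1 - (a / r) ^ 4) * \<rho>, v) (1 / sqrt (1 - (a / r) ^ 4) * \<sigma>, w) =
        eguchi_hanson a (r, q) (\<rho>, v) (\<sigma>, w)"
      unfolding eguchi_hanson_def cyl_metric_def gbar_def prod.case radial sq by simp
  qed (fact \<tau>_pos \<tau>)+
  ultimately show ?thesis
    unfolding T isometric_metrics_def by blast
qed

end
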